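(* For $q\in\{3,5\}$ there exists a large set $\mathrm{LS}_q[2](2,3,6)$; equivalently, there exist a $2$-$(6,3,20)_3$ subspace design and a $2$-$(6,3,78)_5$ subspace design.
   Context: Let $V$ be a $v$-dimensional vector space over $\mathrm{GF}(q)$. A $t$-$(v,k,\lambda)_q$ subspace design is a pair $(V,\mathcal{B})$ where $\mathcal{B}$ is a set of $k$-dimensional subspaces of $V$ such that every $t$-dimensional subspace of $V$ is contained in exactly $\lambda$ elements of $\mathcal{B}$. A large set $\mathrm{LS}_q[N](t,k,v)$ is a collection $\{(V,\mathcal{B}_1),\dots,(V,\mathcal{B}_N)\}$ of $t$-$(v,k,\lambda)_q$ subspace designs (same $\lambda$) such that $\{\mathcal{B}_1,\dots,\mathcal{B}_N\}$ is a partition of the set of all $k$-dimensional subspaces of $V$; for $N=2$ it is called a halving, and then $\lambda=\frac12\begin{bmatrix} v-t\\ k-t\end{bmatrix}_q$ (Gaussian binomial coefficient), which for $(t,k,v)=(2,3,6)$ equals $\frac12(q^2+1)(q+1)$. *)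

theory Defs
  imports "HOL.Vector_Spaces" "HOL-Library.Cardinality" "HOL-Library.Disjoint_Sets"
begin

text \<open>
  The ambient space \<open>V\<close> is the whole type \<open>'v\<close>, with scalar multiplication \<open>scale\<close> over the field
  \<open>'k\<close>; \<open>GF(q)\<close> is any \<open>'k\<close> with \<open>CARD('k) = q\<close>. Sort \<open>finite\<close> on \<open>'v\<close> is equivalent to \<open>V\<close> being
  finite-dimensional, since \<open>'k\<close> is finite. It rules out the convention that \<open>dim\<close> is \<open>0\<close> on
  infinite-dimensional spaces.
\<close>

definition is_space ::
  "nat \<Rightarrow> nat \<Rightarrow> ('k::{field,finite} \<Rightarrow> 'v::{ab_group_add,finite} \<Rightarrow> 'v) \<Rightarrow> bool" where
  "is_space q v scale \<longleftrightarrow>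
     vector_space scale \<and> CARD('k) = q \<and> vector_space.dim scale (UNIV :: 'v set) = v"

definition subspaces_of_dim ::
  "('k::{field,finite} \<Rightarrow> 'v::{ab_group_add,finite} \<Rightarrow> 'v) \<Rightarrow> nat \<Rightarrow> 'v set set" where
  "subspaces_of_dim scale k = {U. module.subspace scale U \<and> vector_space.dim scale U = k}"

text \<open>\<open>(V, \<B>)\<close> is a \<open>t-(v,k,\<lambda>)\<close> subspace design over \<open>GF(q)\<close>,
  with \<open>\<lambda>\<close> written \<open>\<mu>\<close>.\<close>

definition subspace_design ::
  "nat \<Rightarrow> nat \<Rightarrow> nat \<Rightarrow> nat \<Rightarrow> nat \<Rightarrow>
   ('k::{field,finite} \<Rightarrow> 'v::{ab_group_add,finite} \<Rightarrow> 'v) \<Rightarrow> 'v set set \<Rightarrow> bool" where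
  "subspace_design q t v k \<mu> scale \<B> \<longleftrightarrow>
     is_space q v scale \<and> \<B> \<subseteq> subspaces_of_dim scale k \<and>
     (\<forall>T \<in> subspaces_of_dim scale t. card {U \<in> \<B>. T \<subseteq> U} = \<mu>)"

text \<open>\<open>\<L> = {\<B>\<^sub>1, \<dots>, \<B>\<^sub>N}\<close> gives an \<open>LS\<^sub>q[N](t,k,v)\<close> on \<open>V\<close>.\<close>

definition large_set ::
  "nat \<Rightarrow> nat \<Rightarrow> nat \<Rightarrow> nat \<Rightarrow> nat \<Rightarrow>
   ('k::{field,finite} \<Rightarrow> 'v::{ab_group_add,finite} \<Rightarrow> 'v) \<Rightarrow> 'v set set set \<Rightarrow> bool" where
  "large_set q N t k v scale \<L> \<longleftrightarrow>
     is_space q v scale \<and> card \<L> = N \<and>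
     partition_on (subspaces_of_dim scale k) \<L> \<and>
     (\<exists>\<mu>. \<forall>\<B> \<in> \<L>. subspace_design q t v k \<mu> scale \<B>)"

end

theory Submission
  imports Defs "HOL-Library.Product_Plus"
begin

text \<open>
  It suffices to find a function \<open>f\<close> with values 1 and -1 on the planes such that for every line \<open>T\<close> the
  values of \<open>f\<close> on the planes through \<open>T\<close> add up to 0; the two designs are then the level sets of \<open>f\<close>.
  A Singer cycle \<open>\<sigma>\<close> runs through all \<open>n\<close> points, so a subspace \<open>U\<close> becomes a set \<open>logs U\<close> of residues modulo
  \<open>n\<close>, shifted by 1 under \<open>\<sigma>\<close>. We look for \<open>f\<close> with \<open>f (\<sigma> U) = - f U\<close>, so that one line from each orbit of
  \<open>\<sigma>\<close> has to be checked.

  For \<open>q = 5\<close> let \<open>c r\<close> be the number of elements of \<open>logs U\<close> congruent to \<open>r\<close> modulo 6, let \<open>X\<close> be the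
  alternating sum of their squares, and let \<open>N\<close> be the norm of the sum of \<open>\<delta>^i\<close> over \<open>i\<close> in
  \<open>logs U\<close>, where \<open>\<delta>\<close> is an element of norm 1 and order 31 in the field with 125 elements. A shift
  changes the sign of \<open>X\<close> and fixes \<open>N\<close>; as a plane has 31 points, \<open>X\<close> is odd and hence nonzero. So \<open>sgn X\<close>,
  times a sign depending on \<open>|X|\<close> and \<open>N\<close>, changes its sign under \<open>\<sigma>\<close>. It is also invariant under the Frobenius
  map, which leaves 29 orbits of lines.

  For \<open>q = 3\<close> the alternating sum \<open>E\<close> of 1 over \<open>logs U\<close> is odd since a plane has 13 points, and it plays the
  part of \<open>X\<close>. If \<open>S\<close> and \<open>T\<close> are the sums over \<open>logs U\<close> of the powers of 2 and of \<open>1/4\<close> modulo 157,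
  where 2 has order 52, then \<open>S\<^sup>2 T\<close> is invariant under shifts and plays the part of \<open>N\<close>.

  In both cases the additional signs are a solution, found by computer, of the linear equations imposed by the
  line orbits.
\<close>

subsection \<open>Coordinates\<close>

text \<open>Coordinate vectors are constructor terms, so that ground vectors can be compared and
  looked up by rewriting.\<close>

datatype 'a vec6 = V 'a 'a 'a 'a 'a 'a

lemma card_vec6: "CARD('a::finite vec6) = CARD('a) ^ 6"
proof -
  define g :: "'a \<times> 'a \<times> 'a \<times> 'a \<times> 'a \<times> 'a \<Rightarrow> 'a vec6"
    where "g = (\<lambda>(a, b, c, d, e, f). V a b c d e f)"
  have "v \<in> range g" for v
  proof (cases v)
    case (V a b c d e f)
    then show ?thesis by (intro range_eqI[of _ _ "(a, b, c, d, e, f)"]) (simp add: g_def)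
  qed
  then have "range g = UNIV" by auto
  moreover have "inj g" by (auto simp: inj_def g_def)
  ultimately have "CARD('a vec6) = CARD('a \<times> 'a \<times> 'a \<times> 'a \<times> 'a \<times> 'a)"
    using card_image[of g UNIV] by simp
  then show ?thesis by (simp add: eval_nat_numeral)
qed

locale coordinates = vector_space scale
  for scale :: "'k::{field,finite} \<Rightarrow> 'v::{ab_group_add,finite} \<Rightarrow> 'v" (infixr "*s" 75) +
  fixes val :: "'k vec6 \<Rightarrow> 'v"
  assumes bij_val: "bij val"
    and val_add: "val (V a b c d e f) + val (V a' b' c' d' e' f')
      = val (V (a + a') (b + b') (c + c') (d + d') (e + e') (f + f'))"
    and val_scale: "k *s val (V a b c d e f) = val (V (k * a) (k * b) (k * c) (k * d) (k * e) (k * f))"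
begin

lemma val_eq_iff [simp]: "val x = val y \<longleftrightarrow> x = y"
  using bij_val by (metis bij_pointE)

lemma val_zero: "val (V 0 0 0 0 0 0) = 0"
  using val_scale[of 0 0 0 0 0 0 0] by simp

lemma val_diff: "val (V a b c d e f) - val (V a' b' c' d' e' f')
    = val (V (a - a') (b - b') (c - c') (d - d') (e - e') (f - f'))"
  by (simp add: diff_eq_eq val_add)

lemma val_cases: obtains a b c d e f where "v = val (V a b c d e f)"
  by (metis bij_val bij_pointE vec6.exhaust)

lemma val_eq_0_iff [simp]: "val x = 0 \<longleftrightarrow> x = V 0 0 0 0 0 0"
  using val_eq_iff val_zero by metis

lemma card_UNIV_space: "CARD('v) = CARD('k) ^ 6"
  using bij_betw_same_card[OF bij_val] card_vec6 by metis

abbreviation "sub k \<equiv> subspaces_of_dim scale k"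

lemma in_sub_iff: "U \<in> sub k \<longleftrightarrow> subspace U \<and> dim U = k"
  by (simp add: subspaces_of_dim_def)

end

text \<open>Extend \<open>x\<close>, \<open>y\<close> to a basis and number it with \<open>x\<close>
  and \<open>y\<close> first. Prescribing these two vectors allows any given line to be put into
  standard position when planes are counted.\<close>

lemma ex_coordinates:
  fixes scale :: "'k::{field,finite} \<Rightarrow> 'v::{ab_group_add,finite} \<Rightarrow> 'v"
  assumes sp: "is_space q 6 scale"
    and xy: "\<not> module.dependent scale {x, y}" "x \<noteq> y"
  shows "\<exists>val. coordinates scale val \<and> val (V 1 0 0 0 0 0) = x \<and> val (V 0 1 0 0 0 0) = y"
proof -
  from sp interpret vector_space scale by (simp add: is_space_def)
  have d: "dim UNIV = 6" using sp by (simp add: is_space_def)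
  obtain B where B: "{x, y} \<subseteq> B" "independent B" "span B = UNIV"
    using maximal_independent_subset_extend[of "{x, y}" UNIV] xy
    by (metis subset_UNIV top.extremum_uniqueI)
  have "card B = 6" using basis_card_eq_dim[of B UNIV] B d by simp
  then have "card {2..<6::nat} = card (B - {x, y})" using B(1) xy(2) by (subst card_Diff_subset) auto
  then obtain h' where h': "bij_betw h' {2..<6::nat} (B - {x, y})"
    using finite_same_card_bij[of "{2..<6::nat}" "B - {x, y}"] by auto
  define h where "h i = (if i = 0 then x else if i = 1 then y else h' i)" for i :: nat
  have "bij_betw h ({0, 1} \<union> {2..<6}) ({x, y} \<union> (B - {x, y}))"
  proof (rule bij_betw_combine)
    show "bij_betw h {0, 1} {x, y}" using xy(2) by (auto simp: bij_betw_def h_def)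
    show "bij_betw h {2..<6} (B - {x, y})" using h' by (subst bij_betw_cong[of _ _ h']) (auto simp: h_def)
  qed auto
  moreover have "{x, y} \<union> (B - {x, y}) = B" using B(1) by auto
  moreover have "{0, 1} \<union> {2..<6} = {..<6::nat}" by auto
  ultimately have h: "bij_betw h {..<6} B" by simp
  define val where "val v = (case v of V a b c d e f \<Rightarrow>
    scale a (h 0) + (scale b (h 1) + (scale c (h 2) + (scale d (h 3) + (scale e (h 4) + scale f (h 5))))))" for v
  have six: "{..<6::nat} = {0,1,2,3,4,5}" by auto
  have S: "(\<Sum>v\<in>B. scale (u v) v) = val (V (u (h 0)) (u (h 1)) (u (h 2)) (u (h 3)) (u (h 4)) (u (h 5)))" for u
    using sum.reindex_bij_betw[OF h, of "\<lambda>v. scale (u v) v", symmetric]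
    by (simp add: six val_def)
  have add: "val (V a b c d e f) + val (V a' b' c' d' e' f')
      = val (V (a + a') (b + b') (c + c') (d + d') (e + e') (f + f'))" for a b c d e f a' b' c' d' e' f'
    by (simp add: val_def scale_left_distrib ac_simps)
  have mul: "scale k (val (V a b c d e f)) = val (V (k * a) (k * b) (k * c) (k * d) (k * e) (k * f))"
    for k a b c d e f by (simp add: val_def scale_right_distrib)
  have "surj val"
  proof -
    have "v \<in> range val" for v
    proof -
      have "v \<in> span B" using B by simp
      then show ?thesis unfolding span_finite[OF finite] using S by auto
    qed
    then show ?thesis by auto
  qed
  moreover have "inj val"
  proof (rule injI)
    fix v w assume vw: "val v = val w"
    obtain a b c d e f where v: "v = V a b c d e f" by (cases v)
    obtain a' b' c' d' e' f' where w: "w = V a' b' c' d' e' f'" by (cases w)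
    \<comment> \<open>If \<open>val v = val w\<close>, the differences \<open>t\<close> are the
      coefficients of a linear relation on \<open>B\<close>; \<open>u\<close> carries them from
      indices to basis vectors.\<close>
    define t where "t i = (if i = 0 then a - a' else if i = 1 then b - b' else if i = 2 then c - c'
      else if i = 3 then d - d' else if i = 4 then e - e' else f - f')" for i :: nat
    define u where "u z = t (inv_into {..<6} h z)" for z
    have uh: "u (h i) = t i" if "i < 6" for i
      using that h unfolding u_def by (simp add: bij_betw_def)
    have "(\<Sum>v\<in>B. scale (u v) v) + val w = val v"
      unfolding S v w by (simp add: uh add) (simp add: t_def)
    then have "(\<Sum>v\<in>B. scale (u v) v) = 0" using vw by simp
    then have "u z = 0" if "z \<in> B" for z
      using independentD[OF B(2) finite subset_refl] that by blast
    then have "t i = 0" if "i < 6" for i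
      using uh[OF that] h that by (auto simp: bij_betw_def)
    from this[of 0] this[of 1] this[of 2] this[of 3] this[of 4] this[of 5] show "v = w"
      by (simp add: t_def v w)
  qed
  ultimately have "coordinates scale val" using add mul by unfold_locales (auto simp: bij_def)
  moreover have "val (V 1 0 0 0 0 0) = x" "val (V 0 1 0 0 0 0) = y" by (simp_all add: val_def h_def)
  ultimately show ?thesis by blast
qed

section \<open>Halvings from balanced signs on the planes\<close>

context coordinates
begin

text \<open>Over each line the values 1 and -1 balance, so each level set of \<open>f\<close>
  receives half of the \<open>2 * \<mu>\<close> planes.\<close>

lemma halving:
  fixes f :: "'v set \<Rightarrow> int"
  assumes sp: "is_space q 6 scale"
    and f: "\<And>U. U \<in> sub 3 \<Longrightarrow> \<bar>f U\<bar> = 1"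
    and F: "\<And>T. T \<in> sub 2 \<Longrightarrow> (\<Sum>U | U \<in> sub 3 \<and> T \<subseteq> U. f U) = 0"
    and N: "\<And>T. T \<in> sub 2 \<Longrightarrow> card {U \<in> sub 3. T \<subseteq> U} = 2 * \<mu>"
    and T: "T \<in> sub 2" and \<mu>: "\<mu> > 0"
  shows "(\<exists>\<L>. large_set q 2 2 3 6 scale \<L>) \<and> (\<exists>\<B>. subspace_design q 2 6 3 \<mu> scale \<B>)"
proof -
  define B where "B s = {U \<in> sub 3. f U = s}" for s
  have f': "f U = 1 \<or> f U = -1" if "U \<in> sub 3" for U
    using f[OF that] by arith
  have c: "card {U \<in> B s. T \<subseteq> U} = \<mu>" if T: "T \<in> sub 2" and s: "s = 1 \<or> s = -1" for T s
  proof -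
    let ?A = "\<lambda>s. {U \<in> B s. T \<subseteq> U}"
    have e: "{U. U \<in> sub 3 \<and> T \<subseteq> U} = ?A 1 \<union> ?A (-1)" using f' by (auto simp: B_def)
    have d: "?A 1 \<inter> ?A (-1) = {}" by (auto simp: B_def)
    have "(\<Sum>U | U \<in> sub 3 \<and> T \<subseteq> U. f U) = (\<Sum>U\<in>?A 1. 1) + (\<Sum>U\<in>?A (-1). -1)"
      unfolding e using d by (subst sum.union_disjoint) (auto simp: B_def intro!: arg_cong2[where f = plus] sum.cong)
    with F[OF T] have "card (?A 1) = card (?A (-1))" by simp
    moreover have "card (?A 1) + card (?A (-1)) = 2 * \<mu>"
      using N[OF T] card_Un_disjoint[OF _ _ d] e by simp
    ultimately show ?thesis using s by auto
  qed
  have des: "subspace_design q 2 6 3 \<mu> scale (B s)" if "s = 1 \<or> s = -1" for s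
    using sp c that by (auto simp: subspace_design_def B_def)
  \<comment> \<open>The existence of a line \<open>T\<close> and \<open>\<mu> > 0\<close> make both
    level sets nonempty. This is demanded by \<open>partition_on\<close> and also makes the two sets
    different.\<close>
  have ne: "B s \<noteq> {}" if "s = 1 \<or> s = -1" for s
    using c[OF T that] \<mu> by (metis (no_types, lifting) card.empty empty_Collect_eq empty_iff less_irrefl)
  have "large_set q 2 2 3 6 scale {B 1, B (-1)}"
  proof -
    have "B 1 \<noteq> B (-1)" using ne[of 1] by (auto simp: B_def)
    moreover have "B 1 \<union> B (-1) = sub 3" "B 1 \<inter> B (-1) = {}" using f' by (auto simp: B_def)
    then have "partition_on (sub 3) {B 1, B (-1)}"
      using ne[of 1] ne[of "-1"] by (simp add: partition_on_def disjoint_def Int_commute)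
    ultimately show ?thesis using sp des by (auto simp: large_set_def)
  qed
  with des show ?thesis by blast
qed

end

section \<open>Images of subspaces under linear maps\<close>

context vector_space
begin

lemma span_pair_scale: "c \<noteq> 0 \<Longrightarrow> span {x, c *s y} = span {x, y}"
proof -
  assume "c \<noteq> 0"
  then have "y = inverse c *s (c *s y)" by (simp add: scale_scale)
  then have "y \<in> span {x, c *s y}" by (metis insertI1 insert_commute span_base span_scale)
  then show ?thesis unfolding span_eq by (auto intro: span_base span_scale)
qed

end

context coordinates
begin

lemma sub_image:
  assumes g: "Vector_Spaces.linear scale scale g" "inj g" and U: "U \<in> sub k"
  shows "g ` U \<in> sub k"
proof -
  interpret g: Vector_Spaces.linear scale scale g by (rule g)
  obtain B where B: "B \<subseteq> U" "independent B" "U \<subseteq> span B" "card B = dim U"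
    using basis_exists by blast
  have "independent (g ` B)"
    using B g(2) by (intro g.independent_injective_image) (auto intro: inj_on_subset)
  moreover have "g ` U \<subseteq> span (g ` B)" using g.spans_image[OF B(3)] .
  moreover have "card (g ` B) = dim U" using B(4) g(2) by (metis card_image inj_on_subset subset_UNIV)
  ultimately have "dim (g ` U) = dim U" using B(1) by (intro dim_unique[of "g ` B"]) auto
  then show ?thesis using U g.subspace_image by (simp add: in_sub_iff)
qed

definition fsum :: "('v set \<Rightarrow> int) \<Rightarrow> 'v set \<Rightarrow> int" where
  "fsum f T = (\<Sum>U | U \<in> sub 3 \<and> T \<subseteq> U. f U)"

text \<open>\<open>g\<close> permutes the planes and carries those over \<open>T\<close> to those
  over its image. This is used with \<open>\<epsilon> = -1\<close> for the Singer cycle and with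
  \<open>\<epsilon> = 1\<close> for the Frobenius map.\<close>

lemma fsum_image:
  assumes g: "Vector_Spaces.linear scale scale g" "inj g"
    and f: "\<And>U. U \<in> sub 3 \<Longrightarrow> f (g ` U) = \<epsilon> * f U"
  shows "fsum f (g ` T) = \<epsilon> * fsum f T"
proof -
  interpret g: Vector_Spaces.linear scale scale g by (rule g)
  have surj: "surj g" using g(2) by (simp add: finite_UNIV_inj_surj)
  have "bij_betw (\<lambda>U. g ` U) {U. U \<in> sub 3 \<and> T \<subseteq> U} {U. U \<in> sub 3 \<and> g ` T \<subseteq> U}"
  proof (rule bij_betwI[where g = "\<lambda>U. g -` U"])
    show "(\<lambda>U. g -` U) \<in> {U. U \<in> sub 3 \<and> g ` T \<subseteq> U} \<rightarrow> {U. U \<in> sub 3 \<and> T \<subseteq> U}"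
    proof (safe)
      fix U assume U: "U \<in> sub 3" and "g ` T \<subseteq> U"
      have s: "subspace (g -` U)" using U g.subspace_vimage by (simp add: in_sub_iff)
      \<comment> \<open>Mapping the preimage forward gives back \<open>U\<close>, since
        \<open>g\<close> is onto; by \<open>sub_image\<close> both then have the same
        dimension.\<close>
      then have "g ` (g -` U) \<in> sub (dim (g -` U))" by (intro sub_image[OF g]) (simp add: in_sub_iff)
      then show "g -` U \<in> sub 3" using s U surj by (simp add: in_sub_iff)
    qed auto
  qed (use g(2) surj in \<open>auto simp: sub_image[OF g] inj_vimage_image_eq\<close>)
  from sum.reindex_bij_betw[OF this, of f, symmetric]
  have "fsum f (g ` T) = (\<Sum>U | U \<in> sub 3 \<and> T \<subseteq> U. f (g ` U))" by (simp add: fsum_def)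
  also have "\<dots> = \<epsilon> * fsum f T" unfolding fsum_def sum_distrib_left using f by (intro sum.cong) auto
  finally show ?thesis .
qed

lemma sub2_eq_span:
  assumes T: "T \<in> sub 2" and x: "x \<in> T" "x \<noteq> 0" and y: "y \<in> T" "y \<notin> span {x}"
  shows "T = span {x, y}"
proof -
  have i: "independent {x, y}"
    using x y independent_insertI[of y "{x}"] by (simp add: insert_commute)
  have "x \<noteq> y" using y span_base[of x "{x}"] by auto
  then have c: "card {x, y} = dim T" using T by (simp add: in_sub_iff)
  obtain B where "independent B" "span B = UNIV"
    using basis_exists[of UNIV] by (metis subset_UNIV top.extremum_uniqueI)
  then interpret finite_dimensional_vector_space scale B by unfold_locales auto
  show ?thesis
    using subspace_dim_equal[of "span {x, y}" T] T x y i c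
    by (metis dim_span_eq_card_independent empty_subsetI in_sub_iff insert_subset order.refl span_minimal
      subspace_span)
qed

end

subsection \<open>Singer cycles and logarithms of points\<close>

locale lfsr = coordinates scale val
  for scale :: "'k::{field,finite} \<Rightarrow> 'v::{ab_group_add,finite} \<Rightarrow> 'v" (infixr "*s" 75)
    and val :: "'k vec6 \<Rightarrow> 'v" +
  fixes p0 p1 p5 :: 'k
  assumes p0: "p0 \<noteq> 0"
begin

text \<open>Multiplication by \<open>x\<close> modulo $x^6 - p_5 x^5 - p_1 x - p_0$, constant coefficient first.\<close>

fun st :: "'k vec6 \<Rightarrow> 'k vec6" where
  "st (V a b c d e f) = V (p0 * f) (a + p1 * f) b c d (e + p5 * f)"

text \<open>This is the power x^i.\<close>

definition pt :: "nat \<Rightarrow> 'v" where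
  "pt i = val ((st ^^ i) (V 1 0 0 0 0 0))"

definition \<sigma> :: "'v \<Rightarrow> 'v" where
  "\<sigma> v = val (st (inv val v))"

lemma \<sigma>_val: "\<sigma> (val x) = val (st x)"
  using bij_val by (simp add: \<sigma>_def bij_def)

lemma \<sigma>_pt: "\<sigma> (pt i) = pt (Suc i)"
  by (simp add: pt_def \<sigma>_val)

lemma linear_\<sigma>: "Vector_Spaces.linear scale scale \<sigma>"
  unfolding linear_iff
proof (intro conjI allI)
  fix x y show "\<sigma> (x + y) = \<sigma> x + \<sigma> y"
    by (cases x rule: val_cases, cases y rule: val_cases) (simp add: \<sigma>_val val_add algebra_simps)
next
  fix c x show "\<sigma> (c *s x) = c *s \<sigma> x"
    by (cases x rule: val_cases) (simp add: \<sigma>_val val_scale algebra_simps)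
qed unfold_locales

lemma inj_\<sigma>: "inj \<sigma>"
proof (rule injI)
  fix x y assume "\<sigma> x = \<sigma> y"
  then show "x = y"
    using p0 by (cases x rule: val_cases, cases y rule: val_cases) (auto simp: \<sigma>_val)
qed

lemma linear_\<sigma>_pow: "Vector_Spaces.linear scale scale (\<sigma> ^^ i)"
proof (induction i)
  case 0
  show ?case by (simp add: linear_iff vector_space_axioms)
next
  case (Suc i)
  then show ?case unfolding funpow.simps by (rule Vector_Spaces.linear_compose[OF _ linear_\<sigma>])
qed

lemma inj_\<sigma>_pow: "inj (\<sigma> ^^ i)"
  using inj_\<sigma> by (induction i) (auto intro: inj_compose)

lemma \<sigma>_pow_pt: "(\<sigma> ^^ i) (pt j) = pt (i + j)"
  by (induction i) (auto simp: \<sigma>_pt)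

lemma \<sigma>_pow_scale: "(\<sigma> ^^ i) (c *s x) = c *s (\<sigma> ^^ i) x"
  using linear_\<sigma>_pow unfolding linear_iff by blast

lemma pt_nonzero [simp]: "pt i \<noteq> 0"
proof (induction i)
  case 0
  show ?case by (simp add: pt_def)
next
  case (Suc i)
  then show ?case
    using \<sigma>_pow_scale[of 1 0 0] inj_\<sigma> \<sigma>_pt[of i] by (auto dest: injD[of \<sigma> "pt i" 0])
qed

end

text \<open>\<open>card_n\<close> makes \<open>n\<close> the number of points of the space;
  \<open>free\<close> and \<open>wrap\<close> say that x^n is the first positive power of x that is
  a scalar.\<close>

locale singer = lfsr scale val p0 p1 p5
  for scale :: "'k::{field,finite} \<Rightarrow> 'v::{ab_group_add,finite} \<Rightarrow> 'v" (infixr "*s" 75)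
    and val :: "'k vec6 \<Rightarrow> 'v" and p0 p1 p5 :: 'k +
  fixes n :: nat
  assumes n: "0 < n"
    and card_n: "n * (CARD('k) - 1) = CARD('k) ^ 6 - 1"
    and free: "\<lbrakk>0 < i; i < n\<rbrakk> \<Longrightarrow> (st ^^ i) (V 1 0 0 0 0 0) \<noteq> V c 0 0 0 0 0"
    and wrap: "\<exists>c. (st ^^ n) (V 1 0 0 0 0 0) = V c 0 0 0 0 0"
begin

text \<open>Cancelling the injective map \<open>\<sigma> ^^ i\<close> would make x^(j-i) a scalar,
  which \<open>free\<close> excludes.\<close>

lemma pt_unique_less: "i < j \<Longrightarrow> j < n \<Longrightarrow> pt i \<noteq> c *s pt j"
proof
  assume ij: "i < j" "j < n" and e: "pt i = c *s pt j"
  then have c: "c \<noteq> 0" using pt_nonzero[of i] by auto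
  have "(\<sigma> ^^ i) (pt 0) = (\<sigma> ^^ i) (c *s pt (j - i))"
    using e ij by (simp add: \<sigma>_pow_pt \<sigma>_pow_scale)
  then have "pt 0 = c *s pt (j - i)" using inj_\<sigma>_pow by (meson injD)
  then have "pt (j - i) = inverse c *s pt 0" using c by (simp add: scale_scale)
  then have "val ((st ^^ (j - i)) (V 1 0 0 0 0 0)) = val (V (inverse c) 0 0 0 0 0)"
    by (simp add: pt_def val_scale)
  then show False using free[of "j - i"] ij by simp
qed

lemma pt_unique: "i < n \<Longrightarrow> j < n \<Longrightarrow> pt i = c *s pt j \<Longrightarrow> i = j"
proof (rule ccontr)
  assume ij: "i < n" "j < n" "pt i = c *s pt j" "i \<noteq> j"
  then have "c \<noteq> 0" using pt_nonzero[of i] by auto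
  then have "pt j = inverse c *s pt i" using ij by (simp add: scale_scale)
  then show False using pt_unique_less[of i j c] pt_unique_less[of j i "inverse c"] ij by force
qed

text \<open>The nonzero multiples of the first \<open>n\<close> powers are distinct, and by
  \<open>card_n\<close> there are as many of them as nonzero vectors; so they are all of
  them.\<close>

lemma pt_cases:
  assumes "v \<noteq> 0"
  obtains i c where "i < n" "c \<noteq> 0" "v = c *s pt i"
proof -
  let ?f = "\<lambda>(i, c). c *s pt i" and ?A = "{..<n} \<times> (UNIV - {0 :: 'k})"
  have inj: "i = j \<and> c = c'"
    if h: "i < n" "j < n" "c \<noteq> 0" "c *s pt i = c' *s pt j" for i c j c'
  proof -
    have "pt i = inverse c *s (c *s pt i)" using h(3) by (simp add: scale_scale)
    then have "pt i = (inverse c * c') *s pt j" unfolding h(4) by (simp add: scale_scale)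
    then have "i = j" using pt_unique h by blast
    then show ?thesis using h(4) by simp
  qed
  have "inj_on ?f ?A"
  proof (rule inj_onI)
    fix x y assume "x \<in> ?A" "y \<in> ?A" "?f x = ?f y"
    then show "x = y" using inj[of "fst x" "fst y" "snd x" "snd y"]
      by (simp add: split_beta mem_Times_iff prod_eq_iff)
  qed
  then have "card (?f ` ?A) = n * (CARD('k) - 1)"
    by (simp add: card_image card_cartesian_product card_Diff_singleton)
  also have "\<dots> = card (UNIV - {0 :: 'v})"
    using card_n by (simp add: card_Diff_singleton card_UNIV_space)
  finally have "?f ` ?A = UNIV - {0}" by (intro card_subset_eq) auto
  then have "v \<in> ?f ` ?A" using assms by auto
  then show ?thesis using that by auto
qed

lemma pt_add_n: obtains c where "c \<noteq> 0" "\<And>i. pt (i + n) = c *s pt i"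
proof -
  obtain c where c: "pt n = c *s pt 0" using wrap by (auto simp: pt_def val_scale)
  then have "c \<noteq> 0" using pt_nonzero[of n] by auto
  moreover have "pt (i + n) = c *s pt i" for i
    using \<sigma>_pow_pt[of i n] \<sigma>_pow_pt[of i 0] by (simp add: c \<sigma>_pow_scale)
  ultimately show ?thesis using that by blast
qed

lemma pt_mod: obtains c where "c \<noteq> 0" "pt i = c *s pt (i mod n)"
proof -
  obtain c where c: "c \<noteq> 0" "\<And>i. pt (i + n) = c *s pt i" using pt_add_n by blast
  have "\<exists>d. d \<noteq> 0 \<and> pt (j + n * k) = d *s pt j" for j k
  proof (induction k)
    case 0
    show ?case by (intro exI[of _ 1]) simp
  next
    case (Suc k)
    then obtain d where "d \<noteq> 0" "pt (j + n * k) = d *s pt j" by blast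
    then show ?case using c(1) c(2)[of "j + n * k"] by (intro exI[of _ "c * d"]) (simp add: algebra_simps)
  qed
  from this[of "i mod n" "i div n"] show ?thesis using that by auto
qed

lemma pt_mod_in_iff: "subspace U \<Longrightarrow> pt (i mod n) \<in> U \<longleftrightarrow> pt i \<in> U"
proof -
  assume U: "subspace U"
  obtain c where c: "c \<noteq> 0" "pt i = c *s pt (i mod n)" by (rule pt_mod)
  then have "pt (i mod n) = inverse c *s pt i" by (simp add: scale_scale)
  with c U show ?thesis by (metis subspace_scale)
qed

lemma pt_scale_unique: "i < n \<Longrightarrow> c \<noteq> 0 \<Longrightarrow> c *s pt i = d *s pt j \<Longrightarrow> i = j mod n"
proof -
  assume h: "i < n" "c \<noteq> 0" "c *s pt i = d *s pt j"
  obtain e where e: "pt j = e *s pt (j mod n)" by (rule pt_mod)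
  have "pt i = inverse c *s (c *s pt i)" using h(2) by (simp add: scale_scale)
  also have "\<dots> = (inverse c * d * e) *s pt (j mod n)"
    unfolding h(3) by (subst e) (simp add: scale_scale mult.assoc)
  finally have "pt i = (inverse c * d * e) *s pt (j mod n)" .
  then show ?thesis using pt_unique[of i "j mod n"] h n by simp
qed

text \<open>Unspecified at 0.\<close>

definition lg :: "'v \<Rightarrow> nat" where
  "lg v = (THE i. i < n \<and> (\<exists>c. c \<noteq> 0 \<and> v = c *s pt i))"

lemma lg_scale_pt: "c \<noteq> 0 \<Longrightarrow> lg (c *s pt i) = i mod n"
proof -
  assume c: "c \<noteq> 0"
  obtain d where d: "d \<noteq> 0" "pt i = d *s pt (i mod n)" by (rule pt_mod)
  have "c *s pt i = (c * d) *s pt (i mod n)" by (subst d(2)) (simp add: scale_scale)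
  with c d(1) n have "i mod n < n \<and> (\<exists>e. e \<noteq> 0 \<and> c *s pt i = e *s pt (i mod n))"
    by (metis mod_less_divisor mult_eq_0_iff)
  then show ?thesis unfolding lg_def
  proof (rule the_equality)
    fix j assume "j < n \<and> (\<exists>e. e \<noteq> 0 \<and> c *s pt i = e *s pt j)"
    then obtain e where "j < n" "e \<noteq> 0" "e *s pt j = c *s pt i" by metis
    then show "j = i mod n" by (rule pt_scale_unique)
  qed
qed

lemma lg_scale: "c \<noteq> 0 \<Longrightarrow> lg (c *s v) = lg v"
proof (cases "v = 0")
  case False
  assume "c \<noteq> 0"
  moreover obtain i d where "d \<noteq> 0" "v = d *s pt i" using False by (rule pt_cases)
  ultimately show ?thesis using lg_scale_pt[of d i] lg_scale_pt[of "c * d" i] by simp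
qed auto

lemma lg_less: "v \<noteq> 0 \<Longrightarrow> lg v < n"
  by (erule pt_cases) (simp add: lg_scale_pt)

lemma lg_eqE:
  assumes "v \<noteq> 0" obtains c where "c \<noteq> 0" "v = c *s pt (lg v)"
  using assms by (elim pt_cases) (simp add: lg_scale_pt)

lemma lg_\<sigma>: "v \<noteq> 0 \<Longrightarrow> lg (\<sigma> v) = Suc (lg v) mod n"
proof -
  assume "v \<noteq> 0"
  then obtain c where c: "c \<noteq> 0" "v = c *s pt (lg v)" by (rule lg_eqE)
  then have "\<sigma> v = c *s pt (Suc (lg v))"
    using \<sigma>_pow_scale[of 1 c "pt (lg v)"] by (simp add: \<sigma>_pt)
  then show ?thesis using c(1) lg_scale_pt by metis
qed

definition logs :: "'v set \<Rightarrow> nat set" where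
  "logs U = {i. i < n \<and> pt i \<in> U}"

text \<open>The exponent map \<open>m\<close> is left open to cover both the Singer cycle, which
  adds 1, and the Frobenius map, which multiplies by 5.\<close>

lemma logs_image:
  assumes g: "Vector_Spaces.linear scale scale g" and m: "\<And>i. g (pt i) = pt (m i)"
    and U: "subspace U"
  shows "logs (g ` U) = (\<lambda>i. m i mod n) ` logs U"
proof -
  interpret g: Vector_Spaces.linear scale scale g by (rule g)
  have s: "subspace (g ` U)" using g.subspace_image[OF U] .
  show ?thesis
  proof (intro equalityI subsetI)
    fix i assume "i \<in> logs (g ` U)"
    then obtain u where u: "i < n" "u \<in> U" "pt i = g u" by (auto simp: logs_def)
    then have "u \<noteq> 0" using pt_nonzero[of i] g.zero by metis
    then obtain j c where j: "j < n" "c \<noteq> 0" "u = c *s pt j" by (rule pt_cases)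
    then have "pt j = inverse c *s u" by (simp add: scale_scale)
    then have "j \<in> logs U" using j(1) u(2) U by (simp add: logs_def subspace_scale)
    moreover have "1 *s pt i = c *s pt (m j)" using u j m by (simp add: g.scale)
    then have "i = m j mod n" using pt_scale_unique[of i 1] u by auto
    ultimately show "i \<in> (\<lambda>i. m i mod n) ` logs U" by blast
  next
    fix i assume "i \<in> (\<lambda>i. m i mod n) ` logs U"
    then obtain j where "i = m j mod n" "pt j \<in> U" by (auto simp: logs_def)
    then show "i \<in> logs (g ` U)"
      using n m pt_mod_in_iff[OF s, of "m j"] by (auto simp: logs_def intro: rev_image_eqI)
  qed
qed

lemma logs_\<sigma>: "subspace U \<Longrightarrow> logs (\<sigma> ` U) = (\<lambda>i. Suc i mod n) ` logs U"
  using logs_image[OF linear_\<sigma>, of Suc] \<sigma>_pt by simp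

lemma logs_subset: "logs U \<subseteq> {..<n}"
  by (auto simp: logs_def)

lemma pt_notin_span: "i < n \<Longrightarrow> j < n \<Longrightarrow> i \<noteq> j \<Longrightarrow> pt i \<notin> span {pt j}"
  using pt_unique by (auto simp: span_singleton)

lemma span_pts_shift: "span {pt i, pt (i + d)} = (\<sigma> ^^ i) ` span {pt 0, pt d}"
proof -
  interpret g: Vector_Spaces.linear scale scale "\<sigma> ^^ i" by (rule linear_\<sigma>_pow)
  show ?thesis using g.span_image[of "{pt 0, pt d}"] by (simp add: \<sigma>_pow_pt)
qed

lemma span_pts_mod: "span {x, pt (d mod n)} = span {x, pt d}"
proof -
  obtain c where "c \<noteq> 0" "pt d = c *s pt (d mod n)" by (rule pt_mod)
  then show ?thesis by (simp add: span_pair_scale)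
qed

text \<open>The line through the points \<open>a\<close> and \<open>c\<close> is a shift of the line
  through 0 and the difference. Adding \<open>n\<close> first prevents truncated subtraction and
  changes \<open>pt c\<close> only by a scalar.\<close>

lemma sub2_span_pts:
  assumes "T \<in> sub 2" "a < n" "c < n" "a \<noteq> c" "pt a \<in> T" "pt c \<in> T"
  shows "T = (\<sigma> ^^ a) ` span {pt 0, pt ((c + n - a) mod n)}"
proof -
  have "T = span {pt a, pt c}"
    using sub2_eq_span[of T "pt a" "pt c"] assms pt_notin_span[of c a] by simp
  also have "\<dots> = span {pt a, pt (c + n)}"
    using span_pts_mod[of "pt a" "c + n"] assms by simp
  also have "\<dots> = (\<sigma> ^^ a) ` span {pt 0, pt (c + n - a)}"
    using span_pts_shift[of a "c + n - a"] assms by simp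
  finally show ?thesis by (simp add: span_pts_mod)
qed

text \<open>As all pairs of points at distance \<open>d\<close> are shifts of each other, every pair of points on a line
  of sum 0 yields such a \<open>d\<close>.\<close>

definition zero_at :: "('v set \<Rightarrow> int) \<Rightarrow> nat \<Rightarrow> bool" where
  "zero_at f d \<longleftrightarrow> fsum f (span {pt 0, pt d}) = 0"

lemma fsum_shift_eq_0_iff:
  assumes f: "\<And>U. U \<in> sub 3 \<Longrightarrow> f (\<sigma> ` U) = - f U"
  shows "fsum f ((\<sigma> ^^ i) ` T) = 0 \<longleftrightarrow> fsum f T = 0"
proof (induction i)
  case (Suc i)
  have "(\<sigma> ^^ Suc i) ` T = \<sigma> ` ((\<sigma> ^^ i) ` T)" by (simp add: image_comp)
  then show ?case using fsum_image[OF linear_\<sigma> inj_\<sigma>, where f = f and \<epsilon> = "-1"] f Suc by simp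
qed simp

lemma zero_at_diff:
  assumes f: "\<And>U. U \<in> sub 3 \<Longrightarrow> f (\<sigma> ` U) = - f U"
    and "T \<in> sub 2" "a < n" "c < n" "a \<noteq> c" "pt a \<in> T" "pt c \<in> T"
  shows "zero_at f ((c + n - a) mod n) \<longleftrightarrow> fsum f T = 0"
  using sub2_span_pts[OF assms(2-)] fsum_shift_eq_0_iff[where f = f] f by (simp add: zero_at_def)

text \<open>A basis of the line gives two distinct points on it, and their exponents differ by a
  nonzero residue at which \<open>z\<close> applies.\<close>

lemma fsum_eq_0_if_zero_at:
  assumes f: "\<And>U. U \<in> sub 3 \<Longrightarrow> f (\<sigma> ` U) = - f U"
    and z: "\<And>d. 0 < d \<Longrightarrow> d < n \<Longrightarrow> zero_at f d" and T: "T \<in> sub 2"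
  shows "fsum f T = 0"
proof -
  obtain B where B: "B \<subseteq> T" "independent B" "T \<subseteq> span B" "card B = 2"
    using basis_exists[of T] T by (auto simp: in_sub_iff)
  then obtain x y where xy: "B = {x, y}" "x \<noteq> y" by (meson card_2_iff)
  have "x \<noteq> 0" "y \<noteq> 0" using B(2) xy dependent_zero by auto
  then obtain a c k l where *: "a < n" "k \<noteq> 0" "x = k *s pt a" "c < n" "l \<noteq> 0" "y = l *s pt c"
    using pt_cases[of x] pt_cases[of y] by metis
  have "subspace T" using T by (simp add: in_sub_iff)
  moreover have "pt a = inverse k *s x" "pt c = inverse l *s y" using * by (simp_all add: scale_scale)
  ultimately have ac: "pt a \<in> T" "pt c \<in> T" using B(1) xy by (auto intro: subspace_scale)
  have "a \<noteq> c"
  proof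
    assume "a = c"
    then have "x = (k * inverse l) *s y" using * by (simp add: scale_scale)
    then have "x \<in> span {y}" by (auto simp: span_singleton)
    then show False using B(2) xy by (simp add: independent_insert)
  qed
  moreover from this have "(c + n - a) mod n \<noteq> 0"
    using * by (cases "a < c") (auto simp: mod_if)
  ultimately show ?thesis using zero_at_diff[where f = f and a = a and c = c, OF _ T] f * ac z n by simp
qed

end

section \<open>Lines and planes in coordinates\<close>

context vector_space
begin

lemma span_pairE:
  assumes "v \<in> span {x, y}" obtains a b where "v = a *s x + b *s y"
  using assms by (auto simp: span_insert span_singleton) (metis diff_add_cancel add.commute)

lemma span_pairI: "a *s x + b *s y \<in> span {x, y}"
  by (simp add: span_add span_base span_scale)

lemma span_tripleE:
  assumes "v \<in> span {x, y, z}" obtains a b c where "v = a *s x + b *s y + c *s z"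
proof -
  have "v \<in> span (insert z {x, y})" using assms by (simp add: insert_commute)
  then obtain c where "v - c *s z \<in> span {x, y}" by (auto simp: span_insert[of z])
  then obtain a b where "v - c *s z = a *s x + b *s y" by (rule span_pairE)
  then show ?thesis using that by (metis diff_add_cancel)
qed

lemma span_tripleI: "a *s x + b *s y + c *s z \<in> span {x, y, z}"
  by (simp add: span_add span_base span_scale)

end

context coordinates
begin

abbreviation "t1 \<equiv> val (V 1 0 0 0 0 0)"
abbreviation "t2 \<alpha> \<beta> \<gamma> \<delta> \<equiv> val (V 0 1 \<alpha> \<beta> \<gamma> \<delta>)"

text \<open>\<open>t1\<close> will be the point \<open>pt 0\<close> of the Singer cycle. All lines
  that are checked by computation later have this shape.\<close>

definition line :: "'k \<Rightarrow> 'k \<Rightarrow> 'k \<Rightarrow> 'k \<Rightarrow> 'v set" where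
  "line \<alpha> \<beta> \<gamma> \<delta> = span {t1, t2 \<alpha> \<beta> \<gamma> \<delta>}"

definition plane :: "'k \<Rightarrow> 'k \<Rightarrow> 'k \<Rightarrow> 'k \<Rightarrow> 'k vec6 \<Rightarrow> 'v set" where
  "plane \<alpha> \<beta> \<gamma> \<delta> y = span {t1, t2 \<alpha> \<beta> \<gamma> \<delta>, val y}"

lemma in_line_iff:
  "val (V a b c d e f) \<in> line \<alpha> \<beta> \<gamma> \<delta> \<longleftrightarrow> c = b * \<alpha> \<and> d = b * \<beta> \<and> e = b * \<gamma> \<and> f = b * \<delta>"
proof
  assume "val (V a b c d e f) \<in> line \<alpha> \<beta> \<gamma> \<delta>"
  then obtain r s where "val (V a b c d e f) = r *s t1 + s *s t2 \<alpha> \<beta> \<gamma> \<delta>"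
    unfolding line_def by (rule span_pairE)
  then show "c = b * \<alpha> \<and> d = b * \<beta> \<and> e = b * \<gamma> \<and> f = b * \<delta>" by (simp add: val_add val_scale)
next
  assume *: "c = b * \<alpha> \<and> d = b * \<beta> \<and> e = b * \<gamma> \<and> f = b * \<delta>"
  have "val (V a b c d e f) = a *s t1 + b *s t2 \<alpha> \<beta> \<gamma> \<delta>" using * by (simp add: val_add val_scale)
  then show "val (V a b c d e f) \<in> line \<alpha> \<beta> \<gamma> \<delta>" unfolding line_def by (metis span_pairI)
qed

lemma in_plane_iff:
  "val (V a b c d e f) \<in> plane \<alpha> \<beta> \<gamma> \<delta> (V 0 0 w x y z) \<longleftrightarrow>
    (\<exists>k. c = b * \<alpha> + k * w \<and> d = b * \<beta> + k * x \<and> e = b * \<gamma> + k * y \<and> f = b * \<delta> + k * z)"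
proof
  assume "val (V a b c d e f) \<in> plane \<alpha> \<beta> \<gamma> \<delta> (V 0 0 w x y z)"
  then obtain r s k where "val (V a b c d e f) = r *s t1 + s *s t2 \<alpha> \<beta> \<gamma> \<delta> + k *s val (V 0 0 w x y z)"
    unfolding plane_def by (rule span_tripleE)
  then show "\<exists>k. c = b * \<alpha> + k * w \<and> d = b * \<beta> + k * x \<and> e = b * \<gamma> + k * y \<and> f = b * \<delta> + k * z"
    by (auto simp: val_add val_scale)
next
  assume "\<exists>k. c = b * \<alpha> + k * w \<and> d = b * \<beta> + k * x \<and> e = b * \<gamma> + k * y \<and> f = b * \<delta> + k * z"
  then obtain k where "c = b * \<alpha> + k * w \<and> d = b * \<beta> + k * x \<and> e = b * \<gamma> + k * y \<and> f = b * \<delta> + k * z" by blast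
  then have "val (V a b c d e f) = a *s t1 + b *s t2 \<alpha> \<beta> \<gamma> \<delta> + k *s val (V 0 0 w x y z)"
    by (simp add: val_add val_scale)
  then show "val (V a b c d e f) \<in> plane \<alpha> \<beta> \<gamma> \<delta> (V 0 0 w x y z)" unfolding plane_def by (metis span_tripleI)
qed

lemma independent_line: "independent {t1, t2 \<alpha> \<beta> \<gamma> \<delta>}" and card_line: "card {t1, t2 \<alpha> \<beta> \<gamma> \<delta>} = 2"
proof -
  have "t2 \<alpha> \<beta> \<gamma> \<delta> \<notin> span {t1}" by (auto simp: span_singleton val_scale)
  then show "independent {t1, t2 \<alpha> \<beta> \<gamma> \<delta>}"
    using independent_insertI[of "t2 \<alpha> \<beta> \<gamma> \<delta>" "{t1}"] by (simp add: insert_commute)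
qed simp

lemma line_in_sub: "line \<alpha> \<beta> \<gamma> \<delta> \<in> sub 2"
  using independent_line card_line by (simp add: in_sub_iff line_def dim_eq_card_independent)

lemma plane_in_sub:
  assumes "V 0 0 w x y z \<noteq> V 0 0 0 0 0 0"
  shows "plane \<alpha> \<beta> \<gamma> \<delta> (V 0 0 w x y z) \<in> sub 3"
proof -
  have n: "val (V 0 0 w x y z) \<notin> line \<alpha> \<beta> \<gamma> \<delta>" using assms by (simp add: in_line_iff)
  then have "independent (insert (val (V 0 0 w x y z)) {t1, t2 \<alpha> \<beta> \<gamma> \<delta>})"
    unfolding line_def using independent_line by (rule independent_insertI)
  moreover have "card (insert (val (V 0 0 w x y z)) {t1, t2 \<alpha> \<beta> \<gamma> \<delta>}) = 3"
    using card_line by simp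
  ultimately show ?thesis
    by (simp add: in_sub_iff plane_def dim_eq_card_independent insert_commute)
qed

lemma line_subset_plane: "line \<alpha> \<beta> \<gamma> \<delta> \<subseteq> plane \<alpha> \<beta> \<gamma> \<delta> y"
  unfolding line_def plane_def by (rule span_mono) auto

text \<open>One normalised vector for each point of the quotient by a line spanned by \<open>t1\<close> and some \<open>t2\<close>.\<close>

definition normals :: "'k vec6 set" where
  "normals = range (\<lambda>(a, b, c). V 0 0 1 a b c) \<union> (range (\<lambda>(a, b). V 0 0 0 1 a b) \<union>
    (range (\<lambda>a. V 0 0 0 0 1 a) \<union> {V 0 0 0 0 0 1}))"

lemma in_normals [simp]:
  "V 0 0 1 a b c \<in> normals" "V 0 0 0 1 a b \<in> normals" "V 0 0 0 0 1 a \<in> normals" "V 0 0 0 0 0 1 \<in> normals"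
  unfolding normals_def by (auto intro: rev_image_eqI[of "(a, b, c)"] rev_image_eqI[of "(a, b)"])

lemma ex_normal:
  assumes "V 0 0 w x y z \<noteq> V 0 0 0 0 0 0"
  shows "\<exists>k m. k \<noteq> 0 \<and> m \<in> normals \<and> val m = k *s val (V 0 0 w x y z)"
proof -
  consider "w \<noteq> 0" | "w = 0" "x \<noteq> 0" | "w = 0" "x = 0" "y \<noteq> 0" | "w = 0" "x = 0" "y = 0" "z \<noteq> 0"
    using assms by auto
  then show ?thesis
  proof cases
    case 1
    then show ?thesis
      by (intro exI[of _ "inverse w"] exI[of _ "V 0 0 1 (inverse w * x) (inverse w * y) (inverse w * z)"])
        (auto simp: val_scale)
  next
    case 2
    then show ?thesis
      by (intro exI[of _ "inverse x"] exI[of _ "V 0 0 0 1 (inverse x * y) (inverse x * z)"])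
        (auto simp: val_scale)
  next
    case 3
    then show ?thesis
      by (intro exI[of _ "inverse y"] exI[of _ "V 0 0 0 0 1 (inverse y * z)"])
        (auto simp: val_scale)
  next
    case 4
    then show ?thesis
      by (intro exI[of _ "inverse z"] exI[of _ "V 0 0 0 0 0 1"]) (auto simp: val_scale)
  qed
qed

lemma normals_nonzero: "m \<in> normals \<Longrightarrow> \<exists>w x y z. m = V 0 0 w x y z \<and> V 0 0 w x y z \<noteq> V 0 0 0 0 0 0"
  by (auto simp: normals_def)

text \<open>Planes over a line are points of the quotient by it. If one normalised vector lies in
  the plane of another, the two are proportional and hence equal.\<close>

lemma bij_betw_plane:
  "bij_betw (plane \<alpha> \<beta> \<gamma> \<delta>) normals {U. U \<in> sub 3 \<and> line \<alpha> \<beta> \<gamma> \<delta> \<subseteq> U}"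
  unfolding bij_betw_def
proof
  show "inj_on (plane \<alpha> \<beta> \<gamma> \<delta>) normals"
  proof (rule inj_onI)
    fix m m' assume m: "m \<in> normals" "m' \<in> normals" and e: "plane \<alpha> \<beta> \<gamma> \<delta> m = plane \<alpha> \<beta> \<gamma> \<delta> m'"
    obtain w x y z where w: "m = V 0 0 w x y z" using normals_nonzero[OF m(1)] by blast
    obtain w' x' y' z' where w': "m' = V 0 0 w' x' y' z'" using normals_nonzero[OF m(2)] by blast
    have "val m \<in> plane \<alpha> \<beta> \<gamma> \<delta> m'" unfolding e[symmetric] by (simp add: plane_def span_base)
    then obtain k where k: "w = k * w'" "x = k * x'" "y = k * y'" "z = k * z'"
      unfolding w w' in_plane_iff by auto
    with m show "m = m'" unfolding w w' by (auto simp: normals_def)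
  qed
  obtain B where "independent B" "span B = UNIV"
    using basis_exists[of UNIV] by (metis subset_UNIV top.extremum_uniqueI)
  then interpret finite_dimensional_vector_space scale B by unfold_locales auto
  show "plane \<alpha> \<beta> \<gamma> \<delta> ` normals = {U. U \<in> sub 3 \<and> line \<alpha> \<beta> \<gamma> \<delta> \<subseteq> U}" (is "?L = ?R")
  proof (intro equalityI subsetI)
    fix U assume "U \<in> ?L"
    then obtain m where "m \<in> normals" "U = plane \<alpha> \<beta> \<gamma> \<delta> m" by blast
    then show "U \<in> ?R" using plane_in_sub line_subset_plane normals_nonzero[of m] by auto
  next
    fix U assume U: "U \<in> ?R"
    then have sU: "subspace U" and dU: "dim U = 3" by (auto simp: in_sub_iff)
    have "U \<noteq> line \<alpha> \<beta> \<gamma> \<delta>" using dU line_in_sub[of \<alpha> \<beta> \<gamma> \<delta>] by (auto simp: in_sub_iff)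
    then obtain u where u: "u \<in> U" "u \<notin> line \<alpha> \<beta> \<gamma> \<delta>" using U by blast
    obtain a b c d e f where v: "u = val (V a b c d e f)" by (rule val_cases)
    \<comment> \<open>Subtracting the vector of the line with the same first two coordinates leaves
      a vector of \<open>U\<close> that vanishes there.\<close>
    define u' where "u' = V 0 0 (c - b * \<alpha>) (d - b * \<beta>) (e - b * \<gamma>) (f - b * \<delta>)"
    have "val (V a b (b * \<alpha>) (b * \<beta>) (b * \<gamma>) (b * \<delta>)) \<in> U" using U by (auto simp: in_line_iff)
    from subspace_diff[OF sU u(1) this] have u': "val u' \<in> U" by (simp add: v u'_def val_diff)
    have "u' \<noteq> V 0 0 0 0 0 0" using u(2) by (auto simp: u'_def v in_line_iff)
    then obtain k m where m: "m \<in> normals" "val m = k *s val u'" using ex_normal unfolding u'_def by blast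
    then have "val m \<in> U" using u' sU by (simp add: subspace_scale)
    then have "plane \<alpha> \<beta> \<gamma> \<delta> m \<subseteq> U"
      using U sU unfolding plane_def by (intro span_minimal) (auto simp: line_def intro: span_base)
    then have "plane \<alpha> \<beta> \<gamma> \<delta> m = U"
      using plane_in_sub normals_nonzero[OF m(1)] dU sU
      by (intro subspace_dim_equal) (auto simp: in_sub_iff)
    then show "U \<in> ?L" using m(1) by blast
  qed
qed

lemma sum_normals:
  "sum g normals = (\<Sum>a\<in>UNIV. \<Sum>b\<in>UNIV. \<Sum>c\<in>UNIV. g (V 0 0 1 a b c)) + ((\<Sum>a\<in>UNIV. \<Sum>b\<in>UNIV. g (V 0 0 0 1 a b))
    + ((\<Sum>a\<in>UNIV. g (V 0 0 0 0 1 a)) + g (V 0 0 0 0 0 1)))" for g :: "'k vec6 \<Rightarrow> 's::comm_monoid_add"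
proof -
  have "sum g (range (\<lambda>(a, b, c). V 0 0 1 a b c)) = (\<Sum>a\<in>UNIV. \<Sum>b\<in>UNIV. \<Sum>c\<in>UNIV. g (V 0 0 1 a b c))"
    by (subst sum.reindex) (auto simp: inj_def sum.cartesian_product split_def)
  moreover have "sum g (range (\<lambda>(a, b). V 0 0 0 1 a b)) = (\<Sum>a\<in>UNIV. \<Sum>b\<in>UNIV. g (V 0 0 0 1 a b))"
    by (subst sum.reindex) (auto simp: inj_def sum.cartesian_product split_def)
  moreover have "sum g (range (\<lambda>a. V 0 0 0 0 1 a)) = (\<Sum>a\<in>UNIV. g (V 0 0 0 0 1 a))"
    by (subst sum.reindex) (auto simp: inj_def)
  ultimately show ?thesis unfolding normals_def
    by (subst sum.union_disjoint, simp, simp, force, subst sum.union_disjoint, simp, simp, force,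
      subst sum.union_disjoint, simp, simp, force) simp
qed

lemma fsum_line:
  "(\<Sum>U | U \<in> sub 3 \<and> line \<alpha> \<beta> \<gamma> \<delta> \<subseteq> U. g U) = sum (g \<circ> plane \<alpha> \<beta> \<gamma> \<delta>) normals" for g :: "'v set \<Rightarrow> 's::comm_monoid_add"
  using sum.reindex_bij_betw[OF bij_betw_plane, of g \<alpha> \<beta> \<gamma> \<delta>] by simp

text \<open>The number is that of the points of the quotient, a space of dimension 4, obtained by
  summing 1 over \<open>normals\<close>.\<close>

lemma card_over_line:
  "card {U \<in> sub 3. line \<alpha> \<beta> \<gamma> \<delta> \<subseteq> U} = CARD('k) ^ 3 + CARD('k) ^ 2 + CARD('k) + 1"
  using fsum_line[of "\<lambda>_. 1 :: nat" \<alpha> \<beta> \<gamma> \<delta>] sum_normals[of "\<lambda>_. 1 :: nat"]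
  by (simp add: eval_nat_numeral o_def del: sum_constant) (simp add: algebra_simps)

end

section \<open>Numbers of planes over a line and of vectors in a plane\<close>

context coordinates
begin

lemma sub2_obtain:
  assumes "T \<in> sub 2"
  obtains x y where "independent {x, y}" "x \<noteq> y" "T = span {x, y}"
proof -
  obtain B where B: "B \<subseteq> T" "independent B" "T \<subseteq> span B" "card B = 2"
    using basis_exists[of T] assms by (auto simp: in_sub_iff)
  then obtain x y where xy: "B = {x, y}" "x \<noteq> y" by (meson card_2_iff)
  moreover have "T = span {x, y}"
    using B assms xy by (intro equalityI span_minimal) (auto simp: in_sub_iff)
  ultimately show ?thesis using that B(2) by simp
qed

lemma card_over_sub2:
  assumes sp: "is_space q 6 scale" and T: "T \<in> sub 2"
  shows "card {U \<in> sub 3. T \<subseteq> U} = CARD('k) ^ 3 + CARD('k) ^ 2 + CARD('k) + 1"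
proof -
  obtain x y where xy: "independent {x, y}" "x \<noteq> y" "T = span {x, y}" using T by (rule sub2_obtain)
  then obtain val' where val': "coordinates scale val'" "val' (V 1 0 0 0 0 0) = x" "val' (V 0 1 0 0 0 0) = y"
    using ex_coordinates[OF sp xy(1,2)] by blast
  then interpret c: coordinates scale val' by simp
  have "T = c.line 0 0 0 0" using xy val' by (simp add: c.line_def)
  then show ?thesis using c.card_over_line by simp
qed

text \<open>Two basis vectors of \<open>U\<close> are taken as the first two coordinate vectors.
  Then \<open>U\<close> is one of the explicit planes over a line and is parametrised by three
  scalars.\<close>

lemma card_sub3:
  assumes sp: "is_space q 6 scale" and U: "U \<in> sub 3"
  shows "card U = CARD('k) ^ 3"
proof -
  obtain B where B: "B \<subseteq> U" "independent B" "U \<subseteq> span B" "card B = dim U"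
    by (rule basis_exists[of U])
  have "card B = 3" using U B(4) by (simp add: in_sub_iff)
  then obtain x y z where xy: "B = {x, y, z}" "x \<noteq> y" by (auto simp: card_3_iff)
  have i: "independent {x, y}" by (rule independent_mono[OF B(2)]) (simp add: xy(1))
  obtain val' where val': "coordinates scale val'" "val' (V 1 0 0 0 0 0) = x" "val' (V 0 1 0 0 0 0) = y"
    using ex_coordinates[OF sp i xy(2)] by blast
  then interpret c: coordinates scale val' by simp
  have "c.line 0 0 0 0 \<subseteq> U"
    unfolding c.line_def using val' B(1) xy(1) U by (intro span_minimal) (auto simp: in_sub_iff)
  then have "U \<in> c.plane 0 0 0 0 ` c.normals"
    using U c.bij_betw_plane[of 0 0 0 0] by (simp add: bij_betw_def)
  then obtain w where w: "w \<in> c.normals" "U = c.plane 0 0 0 0 w" by (rule imageE)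
  obtain a b e f where m: "w = V 0 0 a b e f" "V 0 0 a b e f \<noteq> V 0 0 0 0 0 0"
    using c.normals_nonzero[OF w(1)] by auto
  have U': "U = c.plane 0 0 0 0 (V 0 0 a b e f)" using w(2) m(1) by simp
  define g where "g = (\<lambda>(r, s, k). val' (V r s (k * a) (k * b) (k * e) (k * f)))"
  have "u \<in> range g" if u: "u \<in> U" for u
  proof -
    obtain r s a' b' e' f' where v: "u = val' (V r s a' b' e' f')" by (rule c.val_cases)
    with u obtain k where "a' = k * a" "b' = k * b" "e' = k * e" "f' = k * f"
      unfolding U' v c.in_plane_iff by auto
    then show ?thesis by (intro range_eqI[of _ _ "(r, s, k)"]) (simp add: g_def v)
  qed
  moreover have "g p \<in> U" for p by (cases p) (auto simp: U' c.in_plane_iff g_def)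
  ultimately have "range g = U" by auto
  moreover have "inj g" using m(2) by (auto simp: inj_def g_def)
  ultimately have "card U = CARD('k \<times> 'k \<times> 'k)" using card_image[of g UNIV] by simp
  then show ?thesis by (simp add: eval_nat_numeral)
qed

end

section \<open>Logarithms of the points of a plane\<close>

context singer
begin

lemma pt_lg:
  assumes "v \<noteq> 0" obtains c where "c \<noteq> 0" "v = c *s pt (lg v)" "pt (lg v) = inverse c *s v"
proof -
  obtain c where c: "c \<noteq> 0" "v = c *s pt (lg v)" using assms by (rule lg_eqE)
  have "inverse c *s v = inverse c *s (c *s pt (lg v))" using c(2) by (rule arg_cong)
  also have "\<dots> = pt (lg v)" using c(1) by (simp add: scale_scale)
  finally show ?thesis using that c by simp
qed

lemma lg_eq_imp:
  assumes "v \<noteq> 0" "w \<noteq> 0" "lg v = lg w"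
  obtains c where "c \<noteq> 0" "v = c *s w"
proof -
  obtain a where a: "a \<noteq> 0" "v = a *s pt (lg v)" using assms(1) by (rule lg_eqE)
  obtain b where b: "b \<noteq> 0" "pt (lg w) = inverse b *s w" using assms(2) by (rule pt_lg)
  note a(2)
  also have "a *s pt (lg v) = (a * inverse b) *s w" unfolding assms(3) b(2) by (simp add: scale_scale)
  finally show ?thesis using that[of "a * inverse b"] a(1) b(1) by simp
qed

lemma lg_in_logs: "subspace U \<Longrightarrow> v \<in> U \<Longrightarrow> v \<noteq> 0 \<Longrightarrow> lg v \<in> logs U"
proof -
  assume U: "subspace U" "v \<in> U" "v \<noteq> 0"
  obtain c where "pt (lg v) = inverse c *s v" using U(3) by (rule pt_lg)
  then show ?thesis using U lg_less by (simp add: logs_def subspace_scale)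
qed

lemma lg_pt: "i < n \<Longrightarrow> lg (pt i) = i"
  using lg_scale_pt[of 1 i] by simp

text \<open>Each point of the plane accounts for its \<open>CARD('k) - 1\<close> nonzero
  multiples.\<close>

lemma card_logs:
  assumes sp: "is_space q 6 scale" and U: "U \<in> sub 3"
  shows "card (logs U) * (CARD('k) - 1) = CARD('k) ^ 3 - 1"
proof -
  have s: "subspace U" using U by (simp add: in_sub_iff)
  let ?f = "\<lambda>(i, c). c *s pt i"
  have "bij_betw ?f (logs U \<times> (UNIV - {0})) (U - {0})"
    unfolding bij_betw_def
  proof
    show "inj_on ?f (logs U \<times> (UNIV - {0}))"
    proof (rule inj_onI)
      fix x y assume xy: "x \<in> logs U \<times> (UNIV - {0})" "y \<in> logs U \<times> (UNIV - {0})" "?f x = ?f y"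
      then have "fst x = fst y"
        using pt_scale_unique[of "fst x" "snd x" "snd y" "fst y"] by (auto simp: logs_def)
      with xy show "x = y" by (auto simp: split_beta prod_eq_iff)
    qed
    show "?f ` (logs U \<times> (UNIV - {0})) = U - {0}"
    proof (intro equalityI subsetI)
      fix v assume v: "v \<in> U - {0}"
      then obtain c where "c \<noteq> 0" "v = c *s pt (lg v)" using lg_eqE[of v] by blast
      then show "v \<in> ?f ` (logs U \<times> (UNIV - {0}))"
        using lg_in_logs[OF s, of v] v by (intro image_eqI[of _ _ "(lg v, c)"]) simp_all
    qed (use s in \<open>auto simp: logs_def subspace_scale\<close>)
  qed
  from bij_betw_same_card[OF this] have "card (logs U) * (CARD('k) - 1) = card (U - {0})"
    by (simp add: card_cartesian_product card_Diff_singleton)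
  also have "\<dots> = CARD('k) ^ 3 - 1"
    using card_sub3[OF sp U] subspace_0[OF s] by (simp add: card_Diff_singleton)
  finally show ?thesis .
qed

text \<open>Every point of the plane has exactly one triple of coefficients whose last nonzero entry
  is 1. Third entry 1 gives the double sum; the remaining triples give the points of the line, kept
  apart because all planes over the line share them.\<close>

lemma sum_logs_plane:
  fixes g :: "nat \<Rightarrow> 's::comm_monoid_add"
  assumes nz: "V 0 0 w x y z \<noteq> V 0 0 0 0 0 0"
  defines "G \<equiv> \<lambda>v. g (lg (val v))"
  shows "(\<Sum>i\<in>logs (plane \<alpha> \<beta> \<gamma> \<delta> (V 0 0 w x y z)). g i) =
    (\<Sum>b\<in>UNIV. \<Sum>a\<in>UNIV. G (V a b (b * \<alpha> + w) (b * \<beta> + x) (b * \<gamma> + y) (b * \<delta> + z)))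
      + (G (V 1 0 0 0 0 0) + (\<Sum>a\<in>UNIV. G (V a 1 \<alpha> \<beta> \<gamma> \<delta>)))"
proof -
  let ?U = "plane \<alpha> \<beta> \<gamma> \<delta> (V 0 0 w x y z)"
  let ?N1 = "range (\<lambda>(b, a). (a, b, 1 :: 'k))" and ?N2 = "range (\<lambda>a. (a :: 'k, 1 :: 'k, 0 :: 'k))"
  let ?N = "?N1 \<union> ({(1, 0, 0)} \<union> ?N2)"
  define m where "m = (\<lambda>(a, b, k). V a b (b * \<alpha> + k * w) (b * \<beta> + k * x) (b * \<gamma> + k * y) (b * \<delta> + k * z))"
  have s: "subspace ?U" by (simp add: plane_def)
  have mU: "val (m p) \<in> ?U" for p
    by (cases p) (auto simp: m_def in_plane_iff)
  have m_inj: "p = p'" if "m p = m p'" for p p'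
    using that nz by (cases p; cases p') (auto simp: m_def)
  have m_nz: "val (m p) \<noteq> 0" if "p \<in> ?N" for p
  proof
    assume "val (m p) = 0"
    then have "m p = m (0, 0, 0)" by (simp add: m_def)
    then have "p = (0, 0, 0)" by (rule m_inj)
    with that show False by auto
  qed
  have m_scale: "c *s val (m (a, b, k)) = val (m (c * a, c * b, c * k))" for c a b k
    by (simp add: m_def val_scale distrib_left mult.assoc)
  have "bij_betw (\<lambda>p. lg (val (m p))) ?N (logs ?U)"
    unfolding bij_betw_def
  proof
    show "inj_on (\<lambda>p. lg (val (m p))) ?N"
    proof (rule inj_onI)
      fix p p' assume p: "p \<in> ?N" "p' \<in> ?N" "lg (val (m p)) = lg (val (m p'))"
      obtain c where c: "c \<noteq> 0" "val (m p) = c *s val (m p')"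
        using lg_eq_imp[OF m_nz[OF p(1)] m_nz[OF p(2)] p(3)] .
      obtain a' b' k' where p': "p' = (a', b', k')" by (cases p')
      have "p = (c * a', c * b', c * k')"
        using c(2) unfolding p' m_scale by (intro m_inj) simp
      with p(1,2) p' c(1) show "p = p'" by auto
    qed
    show "(\<lambda>p. lg (val (m p))) ` ?N = logs ?U"
    proof (intro equalityI subsetI)
      fix i assume "i \<in> (\<lambda>p. lg (val (m p))) ` ?N"
      then obtain p where "p \<in> ?N" "i = lg (val (m p))" by blast
      then show "i \<in> logs ?U" using lg_in_logs[OF s mU m_nz] by simp
    next
      fix i assume i: "i \<in> logs ?U"
      then have pi: "i < n" "pt i \<in> ?U" by (auto simp: logs_def)
      obtain a b c d e f where v: "pt i = val (V a b c d e f)" by (rule val_cases)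
      with pi(2) obtain k where k: "pt i = val (m (a, b, k))" by (auto simp: in_plane_iff m_def)
      have nn: "(a, b, k) \<noteq> (0, 0, 0)"
        using k pt_nonzero[of i] by (auto simp: m_def)
      have "\<exists>c. c \<noteq> 0 \<and> (c * a, c * b, c * k) \<in> ?N"
      proof (cases "k = 0")
        case False
        then show ?thesis by (intro exI[of _ "inverse k"]) (auto intro!: image_eqI[of _ _ "(_, _)"])
      next
        case True
        show ?thesis
        proof (cases "b = 0")
          case False
          with True show ?thesis by (intro exI[of _ "inverse b"]) auto
        next
          case b: True
          with True nn show ?thesis by (intro exI[of _ "inverse a"]) auto
        qed
      qed
      then obtain c where c: "c \<noteq> 0" "(c * a, c * b, c * k) \<in> ?N" by blast
      have "lg (val (m (c * a, c * b, c * k))) = i"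
        using lg_scale[OF c(1), of "pt i"] lg_pt[OF pi(1)] by (simp add: k m_scale)
      with c(2) show "i \<in> (\<lambda>p. lg (val (m p))) ` ?N" by (metis (no_types, lifting) image_eqI)
    qed
  qed
  from sum.reindex_bij_betw[OF this, of g]
  have "sum g (logs ?U) = (\<Sum>p\<in>?N. G (m p))" by (simp add: G_def)
  also have "\<dots> = (\<Sum>p\<in>?N1. G (m p)) + (G (m (1, 0, 0)) + (\<Sum>p\<in>?N2. G (m p)))"
    by (subst sum.union_disjoint, simp, simp, force, subst sum.union_disjoint, simp, simp, force) simp
  also have "(\<Sum>p\<in>?N1. G (m p)) = (\<Sum>b\<in>UNIV. \<Sum>a\<in>UNIV. G (m (a, b, 1)))"
    by (subst sum.reindex) (auto simp: inj_def sum.cartesian_product split_def)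
  also have "(\<Sum>p\<in>?N2. G (m p)) = (\<Sum>a\<in>UNIV. G (m (a, 1, 0)))"
    by (subst sum.reindex) (auto simp: inj_def)
  finally show ?thesis by (simp add: m_def)
qed

end

lemma ex_coordinates_space:
  fixes scale :: "'k::{field,finite} \<Rightarrow> 'v::{ab_group_add,finite} \<Rightarrow> 'v"
  assumes "is_space q 6 scale"
  shows "\<exists>val. coordinates scale val"
proof -
  from assms interpret vector_space scale by (simp add: is_space_def)
  obtain B where B: "independent B" "card B = 6"
    using basis_exists[of UNIV] assms by (metis is_space_def)
  obtain B' where "B' \<subseteq> B" "card B' = 2"
    using obtain_subset_with_card_n[of 2 B] B by auto
  then have "independent B'" "card B' = 2" using B independent_mono by auto
  then show ?thesis using ex_coordinates[OF assms] by (metis card_2_iff)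
qed

text \<open>Translation by 1 permutes the field, so the sum of all elements does not change when 1
  is added \<open>CARD('k)\<close> times.\<close>

lemma of_nat_card_eq_0: "of_nat CARD('k) = (0 :: 'k::{field,finite})"
proof -
  have "(\<Sum>x\<in>UNIV. x) = (\<Sum>x\<in>UNIV. x + (1 :: 'k))"
    by (rule sum.reindex_bij_witness[of _ "\<lambda>x. x + 1" "\<lambda>x. x - 1"]) auto
  then show ?thesis by (simp add: sum.distrib)
qed

text \<open>The innermost application is exposed first, so that rewriting can evaluate each iterate
  instead of building a nested term.\<close>

lemma funpow_numeral_swap: "(f ^^ numeral k) x = (f ^^ pred_numeral k) (f x)"
  by (simp only: numeral_eq_Suc funpow_Suc_right o_apply)

lemma funpow_one: "(f ^^ 1) x = f x" for f :: "'a \<Rightarrow> 'a"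
  by simp

subsection \<open>Evaluation by rewriting\<close>

text \<open>A table of labels is a conjunction of equations obtained by unfolding \<open>blocks\<close>; splitting one flat
  conjunction of several thousand equations into rewrite rules would be too slow.\<close>

primrec runs :: "('v \<Rightarrow> 's) \<Rightarrow> ('v \<Rightarrow> 'v) \<Rightarrow> ('s \<Rightarrow> 's) \<Rightarrow> nat \<Rightarrow> 'v \<Rightarrow> 's \<Rightarrow> bool" where
  "runs T st nx 0 v l = True"
| "runs T st nx (Suc k) v l = (T v = l \<and> runs T st nx k (st v) (nx l))"

primrec blocks :: "('v \<Rightarrow> 's) \<Rightarrow> ('v \<Rightarrow> 'v) \<Rightarrow> ('s \<Rightarrow> 's) \<Rightarrow> nat \<Rightarrow> nat \<Rightarrow> 'v \<Rightarrow> 's \<Rightarrow> bool" where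
  "blocks T st nx k 0 v l = True"
| "blocks T st nx k (Suc m) v l =
    (runs T st nx k v l \<and> blocks T st nx k m ((st ^^ k) v) ((nx ^^ k) l))"

lemma runs_numeral:
  "runs T st nx (numeral k) v l = (T v = l \<and> runs T st nx (pred_numeral k) (st v) (nx l))"
  by (simp only: numeral_eq_Suc runs.simps)

lemma blocks_numeral:
  "blocks T st nx k (numeral m) v l =
    (runs T st nx k v l \<and> blocks T st nx k (pred_numeral m) ((st ^^ k) v) ((nx ^^ k) l))"
  by (simp only: numeral_eq_Suc blocks.simps)

lemma runs_one: "runs T st nx 1 v l = (T v = l)"
  by simp

lemma blocks_one: "blocks T st nx k 1 v l = runs T st nx k v l"
  by simp

lemma runs_if_step:
  assumes "\<And>v. P v \<Longrightarrow> P (st v) \<and> T (st v) = nx (T v)"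
  shows "P v \<Longrightarrow> runs T st nx k v (T v)"
proof (induction k arbitrary: v)
  case (Suc k)
  then show ?case using assms[of v] by (simp, metis)
qed simp

lemma blocks_if_step:
  assumes step: "\<And>v. P v \<Longrightarrow> P (st v) \<and> T (st v) = nx (T v)"
  shows "P v \<Longrightarrow> blocks T st nx k m v (T v)"
proof (induction m arbitrary: v)
  case (Suc m)
  have "P ((st ^^ i) v) \<and> T ((st ^^ i) v) = (nx ^^ i) (T v)" for i
    using Suc.prems step by (induction i) auto
  then show ?case using Suc runs_if_step[of P st T nx v k] step by (metis blocks.simps(2))
qed simp

text \<open>This serves two walks: along the powers of x, and along the differences \<open>d\<close>
  of exponents.\<close>

primrec avoids :: "('v \<Rightarrow> bool) \<Rightarrow> ('v \<Rightarrow> 'v) \<Rightarrow> nat \<Rightarrow> 'v \<Rightarrow> bool" where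
  "avoids P st 0 v = True"
| "avoids P st (Suc k) v = (if P v then False else avoids P st k (st v))"

lemma avoids_numeral:
  "avoids P st (numeral k) v = (if P v then False else avoids P st (pred_numeral k) (st v))"
  by (simp only: numeral_eq_Suc avoids.simps)

lemma avoids_one: "avoids P st 1 v = (\<not> P v)"
  by simp

lemma avoidsD: "avoids P st k v \<Longrightarrow> i < k \<Longrightarrow> \<not> P ((st ^^ i) v)"
proof (induction k arbitrary: i v)
  case (Suc k)
  then show ?case by (cases i) (auto simp: funpow_swap1 split: if_splits)
qed simp

lemmas nat_arith = add_num_simps add_numeral_special[where 'a = nat]
  numeral_plus_numeral[where 'a = nat] add_0_left[where 'a = nat]

text \<open>Apart from the rules on binary numerals themselves, all are instantiated to
  \<open>int\<close>. Sums and products in the finite field are thus left to its own tables.\<close>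

lemmas int_arith =
  add_num_simps mult_num_simps BitM.simps Num.inc.simps sub_num_simps[where 'a = int] dbl_simps[where 'a = int]
  dbl_inc_simps[where 'a = int] dbl_dec_simps[where 'a = int] add_numeral_special[where 'a = int]
  add_neg_numeral_special[where 'a = int] diff_numeral_special[where 'a = int]
  numeral_plus_numeral[where 'a = int] add_neg_numeral_simps[where 'a = int] add_0_left[where 'a = int]
  add_0_right[where 'a = int] minus_zero[where 'a = int] diff_numeral_simps[where 'a = int]
  diff_0[where 'a = int] diff_0_right[where 'a = int] numeral_times_numeral[where 'a = int]
  mult_zero_left[where 'a = int] mult_zero_right[where 'a = int] mult_1_left[where 'a = int]
  mult_1_right[where 'a = int] mult_minus_left[where 'a = int] minus_minus[where 'a = int]

section \<open>Labels of points and sums over planes in computable form\<close>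

context coordinates
begin

definition on_axis :: "'k vec6 \<Rightarrow> bool" where
  "on_axis v \<longleftrightarrow> (\<exists>c. v = V c 0 0 0 0 0)"

lemma on_axis_iff: "on_axis (V a b c d e f) \<longleftrightarrow> b = 0 \<and> c = 0 \<and> d = 0 \<and> e = 0 \<and> f = 0"
  by (auto simp: on_axis_def)

end

context singer
begin

definition tab :: "(nat \<Rightarrow> 's) \<Rightarrow> 'k vec6 \<Rightarrow> 's" where
  "tab lab v = lab (lg (val v))"

lemma tab_scale:
  "k \<noteq> 0 \<Longrightarrow> tab lab (V (k * a) (k * b) (k * c) (k * d) (k * e) (k * f)) = tab lab (V a b c d e f)"
  using lg_scale[of k "val (V a b c d e f)"] by (simp add: tab_def val_scale)

text \<open>A label depends on the point only, so a vector with leading entry \<open>s\<close> may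
  be scaled by the inverse \<open>k\<close>. A table then needs one entry per point.\<close>

lemma normalize_lead:
  assumes "k * s = 1"
  shows "tab lab (V s b c d e f) = tab lab (V 1 (k * b) (k * c) (k * d) (k * e) (k * f))"
    "tab lab (V 0 s c d e f) = tab lab (V 0 1 (k * c) (k * d) (k * e) (k * f))"
    "tab lab (V 0 0 s d e f) = tab lab (V 0 0 1 (k * d) (k * e) (k * f))"
    "tab lab (V 0 0 0 s e f) = tab lab (V 0 0 0 1 (k * e) (k * f))"
    "tab lab (V 0 0 0 0 s f) = tab lab (V 0 0 0 0 1 (k * f))"
    "tab lab (V 0 0 0 0 0 s) = tab lab (V 0 0 0 0 0 1)"
proof -
  have "k \<noteq> 0" using assms by auto
  from tab_scale[OF this, of lab] show
    "tab lab (V s b c d e f) = tab lab (V 1 (k * b) (k * c) (k * d) (k * e) (k * f))"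
    "tab lab (V 0 s c d e f) = tab lab (V 0 1 (k * c) (k * d) (k * e) (k * f))"
    "tab lab (V 0 0 s d e f) = tab lab (V 0 0 1 (k * d) (k * e) (k * f))"
    "tab lab (V 0 0 0 s e f) = tab lab (V 0 0 0 1 (k * e) (k * f))"
    "tab lab (V 0 0 0 0 s f) = tab lab (V 0 0 0 0 1 (k * f))"
    "tab lab (V 0 0 0 0 0 s) = tab lab (V 0 0 0 0 0 1)"
    by (metis assms mult_zero_right)+
qed

lemma st_nonzero: "v \<noteq> V 0 0 0 0 0 0 \<Longrightarrow> st v \<noteq> V 0 0 0 0 0 0"
  using p0 by (cases v) auto

lemma tab_st:
  assumes "v \<noteq> V 0 0 0 0 0 0"
  shows "tab lab (st v) = lab (Suc (lg (val v)) mod n)"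
  using lg_\<sigma>[of "val v"] assms by (simp add: tab_def \<sigma>_val)

lemma lg_first: "lg (val (V 1 0 0 0 0 0)) = 0"
  using lg_pt[of 0] n by (simp add: pt_def)

text \<open>A labelling that follows the recurrence \<open>nx\<close> around the whole cycle,
  including the step from \<open>n - 1\<close> to 0, can be read off along the powers of x. If
  \<open>k * m = n\<close>, every point receives an entry.\<close>

lemma blocks_tab:
  assumes "\<And>i. i < n \<Longrightarrow> lab (Suc i mod n) = nx (lab i)"
  shows "blocks (tab lab) st nx k m (V 1 0 0 0 0 0) (lab 0)"
proof -
  have "blocks (tab lab) st nx k m v (tab lab v)" if "v \<noteq> V 0 0 0 0 0 0" for v
  proof (rule blocks_if_step[where P = "\<lambda>v. v \<noteq> V 0 0 0 0 0 0"])
    fix w :: "'k vec6" assume w: "w \<noteq> V 0 0 0 0 0 0"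
    then show "st w \<noteq> V 0 0 0 0 0 0 \<and> tab lab (st w) = nx (tab lab w)"
      using tab_st[OF w, of lab] assms[OF lg_less[of "val w"]] st_nonzero by (simp add: tab_def)
  qed (rule that)
  from this[of "V 1 0 0 0 0 0"] show ?thesis by (simp add: tab_def lg_first)
qed

definition row :: "('k vec6 \<Rightarrow> 's::comm_monoid_add) \<Rightarrow> 'k \<Rightarrow> 'k \<Rightarrow> 'k \<Rightarrow> 'k \<Rightarrow> 'k \<Rightarrow> 's \<Rightarrow> 's" where
  "row T b w x y z s = (\<Sum>a\<in>UNIV. T (V a b w x y z)) + s"

text \<open>The double sum runs over the points off the line; \<open>s\<close> brings in the share
  of the line.\<close>

definition plane_state ::
  "('k vec6 \<Rightarrow> 's::comm_monoid_add) \<Rightarrow> 'k \<Rightarrow> 'k \<Rightarrow> 'k \<Rightarrow> 'k \<Rightarrow> 'k \<Rightarrow> 'k \<Rightarrow> 'k \<Rightarrow> 'k \<Rightarrow> 's \<Rightarrow> 's" where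
  "plane_state T \<alpha> \<beta> \<gamma> \<delta> w x y z s =
    (\<Sum>b\<in>UNIV. \<Sum>a\<in>UNIV. T (V a b (b * \<alpha> + w) (b * \<beta> + x) (b * \<gamma> + y) (b * \<delta> + z))) + s"

definition line_state :: "('k vec6 \<Rightarrow> 's::comm_monoid_add) \<Rightarrow> 'k \<Rightarrow> 'k \<Rightarrow> 'k \<Rightarrow> 'k \<Rightarrow> 's" where
  "line_state T \<alpha> \<beta> \<gamma> \<delta> = row T 1 \<alpha> \<beta> \<gamma> \<delta> (T (V 1 0 0 0 0 0) + 0)"

definition line_sum ::
  "('s \<Rightarrow> int) \<Rightarrow> ('k vec6 \<Rightarrow> 's::comm_monoid_add) \<Rightarrow> 'k \<Rightarrow> 'k \<Rightarrow> 'k \<Rightarrow> 'k \<Rightarrow> 's \<Rightarrow> int" where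
  "line_sum h T \<alpha> \<beta> \<gamma> \<delta> s =
    (\<Sum>a\<in>UNIV. \<Sum>b\<in>UNIV. \<Sum>c\<in>UNIV. h (plane_state T \<alpha> \<beta> \<gamma> \<delta> 1 a b c s)) +
    ((\<Sum>a\<in>UNIV. \<Sum>b\<in>UNIV. h (plane_state T \<alpha> \<beta> \<gamma> \<delta> 0 1 a b s)) +
    ((\<Sum>a\<in>UNIV. h (plane_state T \<alpha> \<beta> \<gamma> \<delta> 0 0 1 a s)) + h (plane_state T \<alpha> \<beta> \<gamma> \<delta> 0 0 0 1 s)))"

text \<open>The share of the line is computed once and handed to all planes over it.\<close>

lemma fsum_line_eq:
  fixes lab :: "nat \<Rightarrow> 's::comm_monoid_add"
  shows "fsum (\<lambda>U. h (sum lab (logs U))) (line \<alpha> \<beta> \<gamma> \<delta>) =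
    line_sum h (tab lab) \<alpha> \<beta> \<gamma> \<delta> (line_state (tab lab) \<alpha> \<beta> \<gamma> \<delta>)"
proof -
  have "h (sum lab (logs (plane \<alpha> \<beta> \<gamma> \<delta> (V 0 0 w x y z)))) =
      h (plane_state (tab lab) \<alpha> \<beta> \<gamma> \<delta> w x y z (line_state (tab lab) \<alpha> \<beta> \<gamma> \<delta>))"
    if "V 0 0 w x y z \<noteq> V 0 0 0 0 0 0" for w x y z
    using sum_logs_plane[OF that, of lab \<alpha> \<beta> \<gamma> \<delta>]
    by (simp add: plane_state_def line_state_def row_def tab_def add.commute)
  then show ?thesis
    unfolding fsum_def fsum_line sum_normals line_sum_def by simp
qed

lemma line_points_zero_at:
  assumes f: "\<And>U. U \<in> sub 3 \<Longrightarrow> f (\<sigma> ` U) = - f U"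
    and z: "fsum f (line \<alpha> \<beta> \<gamma> \<delta>) = 0"
    and v: "val v \<in> line \<alpha> \<beta> \<gamma> \<delta>" "v \<noteq> V 0 0 0 0 0 0"
    and w: "val w \<in> line \<alpha> \<beta> \<gamma> \<delta>" "w \<noteq> V 0 0 0 0 0 0"
    and ne: "lg (val v) \<noteq> lg (val w)"
  shows "zero_at f ((lg (val w) + n - lg (val v)) mod n)"
proof -
  have s: "subspace (line \<alpha> \<beta> \<gamma> \<delta>)" by (simp add: line_def)
  show ?thesis
    using zero_at_diff[where f = f, OF _ line_in_sub[of \<alpha> \<beta> \<gamma> \<delta>] _ _ ne] f z v w lg_in_logs[OF s v(1)]
      lg_in_logs[OF s w(1)]
    by (simp add: logs_def)
qed

lemma sum_logs_\<sigma>: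
  fixes lab :: "nat \<Rightarrow> 's::comm_monoid_add"
  assumes "subspace U"
  shows "sum lab (logs (\<sigma> ` U)) = (\<Sum>i\<in>logs U. lab (Suc i mod n))"
proof -
  have "inj_on (\<lambda>i. Suc i mod n) {..<n}"
    by (rule inj_onI) (auto simp: mod_if split: if_splits)
  then have "inj_on (\<lambda>i. Suc i mod n) (logs U)" by (rule inj_on_subset[OF _ logs_subset])
  then show ?thesis unfolding logs_\<sigma>[OF assms] by (simp add: sum.reindex)
qed

end

subsection \<open>The field with five elements\<close>

type_synonym 'a state5 = "int \<times> int \<times> int \<times> int \<times> int \<times> int \<times> 'a \<times> 'a \<times> 'a"

locale space5 = coordinates scale val
  for scale :: "'k::{field,finite} \<Rightarrow> 'v::{ab_group_add,finite} \<Rightarrow> 'v" (infixr "*s" 75)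
    and val :: "'k vec6 \<Rightarrow> 'v" +
  assumes card5: "CARD('k) = 5"
begin

lemma five: "(5 :: 'k) = 0"
  using of_nat_card_eq_0[where 'k = 'k] card5 by simp

lemma num5: "(6 :: 'k) = 1" "(7 :: 'k) = 2" "(8 :: 'k) = 3" "(9 :: 'k) = 4" "(12 :: 'k) = 2" "(16 :: 'k) = 1"
proof -
  have "(6 :: 'k) = 5 + 1" "(7 :: 'k) = 5 + 2" "(8 :: 'k) = 5 + 3" "(9 :: 'k) = 5 + 4"
    "(12 :: 'k) = 5 + 5 + 2" "(16 :: 'k) = 5 + 5 + 5 + 1" by simp_all
  then show "(6 :: 'k) = 1" "(7 :: 'k) = 2" "(8 :: 'k) = 3" "(9 :: 'k) = 4" "(12 :: 'k) = 2" "(16 :: 'k) = 1"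
    by (simp_all only: five) simp_all
qed

lemma plus5:
  "(0 :: 'k) + 0 = 0" "(0 :: 'k) + 1 = 1" "(0 :: 'k) + 2 = 2" "(0 :: 'k) + 3 = 3" "(0 :: 'k) + 4 = 4"
  "(1 :: 'k) + 0 = 1" "(1 :: 'k) + 1 = 2" "(1 :: 'k) + 2 = 3" "(1 :: 'k) + 3 = 4" "(1 :: 'k) + 4 = 0"
  "(2 :: 'k) + 0 = 2" "(2 :: 'k) + 1 = 3" "(2 :: 'k) + 2 = 4" "(2 :: 'k) + 3 = 0" "(2 :: 'k) + 4 = 1"
  "(3 :: 'k) + 0 = 3" "(3 :: 'k) + 1 = 4" "(3 :: 'k) + 2 = 0" "(3 :: 'k) + 3 = 1" "(3 :: 'k) + 4 = 2"
  "(4 :: 'k) + 0 = 4" "(4 :: 'k) + 1 = 0" "(4 :: 'k) + 2 = 1" "(4 :: 'k) + 3 = 2" "(4 :: 'k) + 4 = 3"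
  by (simp_all add: five num5)

lemma times5:
  "(0 :: 'k) * 0 = 0" "(0 :: 'k) * 1 = 0" "(0 :: 'k) * 2 = 0" "(0 :: 'k) * 3 = 0" "(0 :: 'k) * 4 = 0"
  "(1 :: 'k) * 0 = 0" "(1 :: 'k) * 1 = 1" "(1 :: 'k) * 2 = 2" "(1 :: 'k) * 3 = 3" "(1 :: 'k) * 4 = 4"
  "(2 :: 'k) * 0 = 0" "(2 :: 'k) * 1 = 2" "(2 :: 'k) * 2 = 4" "(2 :: 'k) * 3 = 1" "(2 :: 'k) * 4 = 3"
  "(3 :: 'k) * 0 = 0" "(3 :: 'k) * 1 = 3" "(3 :: 'k) * 2 = 1" "(3 :: 'k) * 3 = 4" "(3 :: 'k) * 4 = 2"
  "(4 :: 'k) * 0 = 0" "(4 :: 'k) * 1 = 4" "(4 :: 'k) * 2 = 3" "(4 :: 'k) * 3 = 2" "(4 :: 'k) * 4 = 1"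
  by (simp_all add: five num5)

lemma distinct5:
  "((0 :: 'k) = 1) = False" "((0 :: 'k) = 2) = False" "((0 :: 'k) = 3) = False" "((0 :: 'k) = 4) = False"
  "((1 :: 'k) = 0) = False" "((1 :: 'k) = 2) = False" "((1 :: 'k) = 3) = False" "((1 :: 'k) = 4) = False"
  "((2 :: 'k) = 0) = False" "((2 :: 'k) = 1) = False" "((2 :: 'k) = 3) = False" "((2 :: 'k) = 4) = False"
  "((3 :: 'k) = 0) = False" "((3 :: 'k) = 1) = False" "((3 :: 'k) = 2) = False" "((3 :: 'k) = 4) = False"
  "((4 :: 'k) = 0) = False" "((4 :: 'k) = 1) = False" "((4 :: 'k) = 2) = False" "((4 :: 'k) = 3) = False"
proof -
  have 2: "(2 :: 'k) \<noteq> 0"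
  proof
    assume "(2 :: 'k) = 0"
    moreover have "(5 :: 'k) = 2 * 2 + 1" by simp
    ultimately show False using five by simp
  qed
  moreover have 3: "(3 :: 'k) \<noteq> 0"
  proof
    assume "(3 :: 'k) = 0"
    moreover have "(5 :: 'k) = 3 + 2" by simp
    ultimately show False using five 2 by (metis add_0)
  qed
  moreover have 4: "(4 :: 'k) \<noteq> 0"
  proof -
    have "(4 :: 'k) = 2 * 2" by simp
    then show ?thesis using 2 by (metis mult_eq_0_iff)
  qed
  moreover have "(4 :: 'k) = 3 + 1" "(4 :: 'k) = 2 + 2" "(3 :: 'k) = 2 + 1" by simp_all
  ultimately show
    "((0 :: 'k) = 1) = False" "((0 :: 'k) = 2) = False" "((0 :: 'k) = 3) = False" "((0 :: 'k) = 4) = False"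
    "((1 :: 'k) = 0) = False" "((1 :: 'k) = 2) = False" "((1 :: 'k) = 3) = False" "((1 :: 'k) = 4) = False"
    "((2 :: 'k) = 0) = False" "((2 :: 'k) = 1) = False" "((2 :: 'k) = 3) = False" "((2 :: 'k) = 4) = False"
    "((3 :: 'k) = 0) = False" "((3 :: 'k) = 1) = False" "((3 :: 'k) = 2) = False" "((3 :: 'k) = 4) = False"
    "((4 :: 'k) = 0) = False" "((4 :: 'k) = 1) = False" "((4 :: 'k) = 2) = False" "((4 :: 'k) = 3) = False"
    by (metis add_cancel_right_left add_cancel_left_left one_add_one add.assoc add_left_cancel zero_neq_one)+
qed

lemma UNIV5: "(UNIV :: 'k set) = {0, 1, 2, 3, 4}"
proof -
  have "card {0, 1, 2, 3, 4 :: 'k} = 5" by (simp add: distinct5)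
  then show ?thesis using card5 card_subset_eq[of "UNIV :: 'k set" "{0, 1, 2, 3, 4}"] by simp
qed

lemma all5: "(\<forall>a. P a) \<longleftrightarrow> P 0 \<and> P 1 \<and> P 2 \<and> P 3 \<and> P (4 :: 'k)"
  using UNIV5 by (metis UNIV_I insertE empty_iff)

lemma sum5: "(\<Sum>a\<in>UNIV. g a) = g 0 + (g 1 + (g 2 + (g 3 + g (4 :: 'k))))"
  unfolding UNIV5 by (simp add: distinct5)

text \<open>\<open>x\<close> has order $3906 = (5^6 - 1) / 4$ modulo scalars in the field defined by $x^6 - x - 3$.\<close>

sublocale lfsr scale val 3 1 0
  by unfold_locales (simp add: distinct5)

lemma st5: "st (V a b c d e f) = V (3 * f) (a + f) b c d e"
  by simp

text \<open>The vectors visited are x, ..., x^3905.\<close>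

lemma avoids_axis: "avoids on_axis st 3905 (st (V 1 0 0 0 0 0))"
  by (simp only: avoids_numeral avoids.simps st5 on_axis_iff plus5 times5 distinct5 simp_thms if_True if_False
    pred_numeral_simps BitM.simps refl)

text \<open>The scalar is the norm of x, which is the constant term -3 = 2 of the defining
  polynomial.\<close>

lemma st_3906: "(st ^^ 3906) (V 1 0 0 0 0 0) = V 2 0 0 0 0 0"
  by (simp only: funpow_numeral_swap funpow_one st5 plus5 times5 pred_numeral_simps BitM.simps numeral_One
    funpow.simps(1) id_apply)

sublocale singer scale val 3 1 0 3906
proof
  fix i c assume i: "0 < i" "i < (3906 :: nat)"
  then obtain j where j: "i = Suc j" by (cases i) auto
  have "\<not> on_axis ((st ^^ j) (st (V 1 0 0 0 0 0)))"
    using avoidsD[OF avoids_axis, of j] i j by simp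
  then show "(st ^^ i) (V 1 0 0 0 0 0) \<noteq> V c 0 0 0 0 0"
    by (auto simp: j funpow_swap1 on_axis_def)
qed (auto simp: card5 st_3906)

text \<open>The first six components count residues modulo 6. The last three are coordinates with respect to
  $1, \<delta>, \<delta>^2$, where $\<delta>^3 = 1 + 4\<delta> + 3\<delta>^2$; \<open>act\<close> multiplies them by $\<delta>$.\<close>

definition onehot :: "nat \<Rightarrow> 'k \<Rightarrow> 'k \<Rightarrow> 'k \<Rightarrow> 'k state5" where
  "onehot r a b c = (of_bool (r = 0), of_bool (r = 1), of_bool (r = 2), of_bool (r = 3),
    of_bool (r = 4), of_bool (r = 5), a, b, c)"

fun act :: "'k state5 \<Rightarrow> 'k state5" where
  "act (c0, c1, c2, c3, c4, c5, a, b, c) =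
    (c5, c0, c1, c2, c3, c4, c, a + 4 * c, b + 3 * c)"

lemma act_onehot:
  "act (onehot 0 a b c) = onehot 1 c (a + 4 * c) (b + 3 * c)"
  "act (onehot 1 a b c) = onehot 2 c (a + 4 * c) (b + 3 * c)"
  "act (onehot 2 a b c) = onehot 3 c (a + 4 * c) (b + 3 * c)"
  "act (onehot 3 a b c) = onehot 4 c (a + 4 * c) (b + 3 * c)"
  "act (onehot 4 a b c) = onehot 5 c (a + 4 * c) (b + 3 * c)"
  "act (onehot 5 a b c) = onehot 0 c (a + 4 * c) (b + 3 * c)"
  by (simp_all add: onehot_def)

lemma onehot_plus:
  "onehot 0 a b c + (c0, c1, c2, c3, c4, c5, x, y, z) = (c0 + 1, c1, c2, c3, c4, c5, a + x, b + y, c + z)"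
  "onehot 1 a b c + (c0, c1, c2, c3, c4, c5, x, y, z) = (c0, c1 + 1, c2, c3, c4, c5, a + x, b + y, c + z)"
  "onehot 2 a b c + (c0, c1, c2, c3, c4, c5, x, y, z) = (c0, c1, c2 + 1, c3, c4, c5, a + x, b + y, c + z)"
  "onehot 3 a b c + (c0, c1, c2, c3, c4, c5, x, y, z) = (c0, c1, c2, c3 + 1, c4, c5, a + x, b + y, c + z)"
  "onehot 4 a b c + (c0, c1, c2, c3, c4, c5, x, y, z) = (c0, c1, c2, c3, c4 + 1, c5, a + x, b + y, c + z)"
  "onehot 5 a b c + (c0, c1, c2, c3, c4, c5, x, y, z) = (c0, c1, c2, c3, c4, c5 + 1, a + x, b + y, c + z)"
  by (simp_all add: onehot_def)

definition lab :: "nat \<Rightarrow> 'k state5" where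
  "lab i = (act ^^ i) (onehot 0 1 0 0)"

text \<open>186 = 6 * 31 combines the residues modulo 6 with the order 31 of \<delta>. Since 3906 =
  21 * 186, labels are well defined on exponents modulo 3906.\<close>

lemma lab_186: "lab 186 = onehot 0 1 0 0"
  unfolding lab_def
  by (simp only: funpow_numeral_swap funpow_one act_onehot plus5 times5 pred_numeral_simps BitM.simps
    numeral_One funpow.simps(1) id_apply)

lemma lab_add: "lab (i + 186 * k) = lab i"
proof (induction k)
  case (Suc k)
  have e: "i + 186 * Suc k = (i + 186 * k) + 186" by simp
  have "lab (i + 186 * Suc k) = (act ^^ (i + 186 * k)) (lab 186)"
    unfolding e lab_def funpow_add o_apply by (rule refl)
  also have "\<dots> = lab (i + 186 * k)" by (simp only: lab_186) (simp only: lab_def)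
  finally show ?case using Suc by simp
qed simp

lemma lab_mod: "lab (i mod 3906) = lab i"
proof -
  have "lab (i mod 3906) = lab (i mod 3906 + 186 * (21 * (i div 3906)))" by (simp only: lab_add)
  also have "i mod 3906 + 186 * (21 * (i div 3906)) = i" by simp
  finally show ?thesis .
qed

lemma lab_Suc: "lab (Suc i mod 3906) = act (lab i)"
  unfolding lab_mod by (simp add: lab_def)

text \<open>63 blocks of length 62 cover all 3906 points.\<close>

lemmas table_raw = blocks_tab[where lab = lab and nx = act and k = 62 and m = 63, OF lab_Suc]

lemma lab_0: "lab 0 = onehot 0 1 0 0"
  by (simp add: lab_def)

lemmas normalize5 = normalize_lead[OF times5(18)] normalize_lead[OF times5(14)] normalize_lead[OF times5(25)]

lemmas table_blocks = table_raw[unfolded lab_0, simplified blocks_one blocks_numeral blocks.simps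
  funpow_numeral_swap funpow_one
  funpow.simps(1) id_apply act_onehot st5 plus5 times5 pred_numeral_simps BitM.simps numeral_One simp_thms]

lemmas table = table_blocks[simplified runs_numeral runs_one normalize5 act_onehot st5 plus5 times5 pred_numeral_simps
  BitM.simps numeral_One simp_thms]

lemma row5: "row T b w x y z s = T (V 0 b w x y z) + (T (V 1 b w x y z) + (T (V 2 b w x y z) +
    (T (V 3 b w x y z) + (T (V 4 b w x y z) + s))))"
  by (simp add: row_def sum5 add.assoc)

lemma plane_state5: "plane_state T \<alpha> \<beta> \<gamma> \<delta> w x y z s =
  row T 0 w x y z (row T 1 (\<alpha> + w) (\<beta> + x) (\<gamma> + y) (\<delta> + z)
    (row T 2 (2 * \<alpha> + w) (2 * \<beta> + x) (2 * \<gamma> + y) (2 * \<delta> + z)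
    (row T 3 (3 * \<alpha> + w) (3 * \<beta> + x) (3 * \<gamma> + y) (3 * \<delta> + z)
    (row T 4 (4 * \<alpha> + w) (4 * \<beta> + x) (4 * \<gamma> + y) (4 * \<delta> + z) s))))"
  unfolding plane_state_def row_def
    sum5[of "\<lambda>b. \<Sum>a\<in>UNIV. T (V a b (b * \<alpha> + w) (b * \<beta> + x) (b * \<gamma> + y) (b * \<delta> + z))"]
  by (simp add: add.assoc)

lemma zero_state5: "0 = (0, 0, 0, 0, 0, 0, 0 :: 'k, 0 :: 'k, 0 :: 'k)"
  by (simp add: zero_prod_def)

text \<open>The determinant of the multiplication by $a + b\<delta> + c\<delta>^2$, i.e. its norm.\<close>

definition nu :: "'k \<Rightarrow> 'k \<Rightarrow> 'k \<Rightarrow> 'k" where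
  "nu a b c = (let d = a + 4 * c; e = b + 3 * c; f = c + 4 * e; g = d + 3 * e in
    a * (d * g - e * f) - b * (c * g - e * e) + c * (c * f - d * e))"

text \<open>The values of |X| that receive the additional sign 1 when the norm is \<open>x\<close>.
  For example, 961 = 31^2 with norm 0 occurs for the subfield with 125 elements: its 31 points have
  the exponents divisible by 126, all in one class modulo 6, and the powers of \<delta> sum to
  0.\<close>

definition good :: "'k \<Rightarrow> int set" where
  "good x = (if x = 0 then {961}
    else if x = 1 then {13, 15, 43, 47, 49, 53, 57, 73, 95, 107, 179}
    else if x = 2 then {37, 41, 57, 69, 73, 83, 87, 101}
    else if x = 3 then {5, 7, 21, 23, 35, 51, 55, 59, 65, 83, 105, 161}
    else {29, 31, 33, 53, 55, 59, 91, 103, 107, 135, 183})"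

definition sgn5 :: "'k \<Rightarrow> int \<Rightarrow> int" where
  "sgn5 \<nu> x = sgn x * (if \<bar>x\<bar> \<in> good \<nu> then 1 else -1)"

fun plane_sign :: "'k state5 \<Rightarrow> int" where
  "plane_sign (c0, c1, c2, c3, c4, c5, a, b, c) =
    sgn5 (nu a b c) (c0 * c0 + c2 * c2 + c4 * c4 - (c1 * c1 + c3 * c3 + c5 * c5))"

lemma nu5:
  "nu 0 0 0 = 0" "nu 0 0 1 = 1" "nu 0 0 2 = 3" "nu 0 0 3 = 2" "nu 0 0 4 = 4"
  "nu 0 1 0 = 1" "nu 0 1 1 = 1" "nu 0 1 2 = 4" "nu 0 1 3 = 1" "nu 0 1 4 = 3"
  "nu 0 2 0 = 3" "nu 0 2 1 = 3" "nu 0 2 2 = 3" "nu 0 2 3 = 4" "nu 0 2 4 = 2"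
  "nu 0 3 0 = 2" "nu 0 3 1 = 3" "nu 0 3 2 = 1" "nu 0 3 3 = 2" "nu 0 3 4 = 2"
  "nu 0 4 0 = 4" "nu 0 4 1 = 2" "nu 0 4 2 = 4" "nu 0 4 3 = 1" "nu 0 4 4 = 4"
  "nu 1 0 0 = 1" "nu 1 0 1 = 4" "nu 1 0 2 = 3" "nu 1 0 3 = 4" "nu 1 0 4 = 3"
  "nu 1 1 0 = 1" "nu 1 1 1 = 3" "nu 1 1 2 = 3" "nu 1 1 3 = 2" "nu 1 1 4 = 1"
  "nu 1 2 0 = 4" "nu 1 2 1 = 1" "nu 1 2 2 = 3" "nu 1 2 3 = 1" "nu 1 2 4 = 1"
  "nu 1 3 0 = 1" "nu 1 3 1 = 4" "nu 1 3 2 = 4" "nu 1 3 3 = 2" "nu 1 3 4 = 4"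
  "nu 1 4 0 = 3" "nu 1 4 1 = 3" "nu 1 4 2 = 2" "nu 1 4 3 = 1" "nu 1 4 4 = 1"
  "nu 2 0 0 = 3" "nu 2 0 1 = 2" "nu 2 0 2 = 2" "nu 2 0 3 = 4" "nu 2 0 4 = 4"
  "nu 2 1 0 = 3" "nu 2 1 1 = 1" "nu 2 1 2 = 2" "nu 2 1 3 = 2" "nu 2 1 4 = 2"
  "nu 2 2 0 = 3" "nu 2 2 1 = 1" "nu 2 2 2 = 4" "nu 2 2 3 = 3" "nu 2 2 4 = 4"
  "nu 2 3 0 = 4" "nu 2 3 1 = 3" "nu 2 3 2 = 4" "nu 2 3 3 = 3" "nu 2 3 4 = 1"
  "nu 2 4 0 = 2" "nu 2 4 1 = 3" "nu 2 4 2 = 3" "nu 2 4 3 = 3" "nu 2 4 4 = 4"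
  "nu 3 0 0 = 2" "nu 3 0 1 = 1" "nu 3 0 2 = 1" "nu 3 0 3 = 3" "nu 3 0 4 = 3"
  "nu 3 1 0 = 3" "nu 3 1 1 = 1" "nu 3 1 2 = 2" "nu 3 1 3 = 2" "nu 3 1 4 = 2"
  "nu 3 2 0 = 1" "nu 3 2 1 = 4" "nu 3 2 2 = 2" "nu 3 2 3 = 1" "nu 3 2 4 = 2"
  "nu 3 3 0 = 2" "nu 3 3 1 = 1" "nu 3 3 2 = 2" "nu 3 3 3 = 1" "nu 3 3 4 = 4"
  "nu 3 4 0 = 2" "nu 3 4 1 = 3" "nu 3 4 2 = 3" "nu 3 4 3 = 3" "nu 3 4 4 = 4"
  "nu 4 0 0 = 4" "nu 4 0 1 = 2" "nu 4 0 2 = 1" "nu 4 0 3 = 2" "nu 4 0 4 = 1"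
  "nu 4 1 0 = 2" "nu 4 1 1 = 4" "nu 4 1 2 = 4" "nu 4 1 3 = 3" "nu 4 1 4 = 2"
  "nu 4 2 0 = 4" "nu 4 2 1 = 1" "nu 4 2 2 = 3" "nu 4 2 3 = 1" "nu 4 2 4 = 1"
  "nu 4 3 0 = 1" "nu 4 3 1 = 4" "nu 4 3 2 = 4" "nu 4 3 3 = 2" "nu 4 3 4 = 4"
  "nu 4 4 0 = 4" "nu 4 4 1 = 4" "nu 4 4 2 = 3" "nu 4 4 3 = 2" "nu 4 4 4 = 2"
proof -
  \<comment> \<open>In characteristic 5 subtraction is addition of the fourfold, so
    \<open>plus5\<close> and \<open>times5\<close> suffice to evaluate every determinant.\<close>
  have z: "4 * x + x = 0" for x :: 'k
    using distrib_right[of 4 1 x] by (simp add: five)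
  have n: "- x = 4 * x" for x :: 'k
    using z[of x] by (simp add: minus_unique[of x] add.commute)
  have m: "x - y = x + 4 * y" for x y :: 'k
    unfolding diff_conv_add_uminus n ..
  show   "nu 0 0 0 = 0" "nu 0 0 1 = 1" "nu 0 0 2 = 3" "nu 0 0 3 = 2" "nu 0 0 4 = 4"
  "nu 0 1 0 = 1" "nu 0 1 1 = 1" "nu 0 1 2 = 4" "nu 0 1 3 = 1" "nu 0 1 4 = 3"
  "nu 0 2 0 = 3" "nu 0 2 1 = 3" "nu 0 2 2 = 3" "nu 0 2 3 = 4" "nu 0 2 4 = 2"
  "nu 0 3 0 = 2" "nu 0 3 1 = 3" "nu 0 3 2 = 1" "nu 0 3 3 = 2" "nu 0 3 4 = 2"
  "nu 0 4 0 = 4" "nu 0 4 1 = 2" "nu 0 4 2 = 4" "nu 0 4 3 = 1" "nu 0 4 4 = 4"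
  "nu 1 0 0 = 1" "nu 1 0 1 = 4" "nu 1 0 2 = 3" "nu 1 0 3 = 4" "nu 1 0 4 = 3"
  "nu 1 1 0 = 1" "nu 1 1 1 = 3" "nu 1 1 2 = 3" "nu 1 1 3 = 2" "nu 1 1 4 = 1"
  "nu 1 2 0 = 4" "nu 1 2 1 = 1" "nu 1 2 2 = 3" "nu 1 2 3 = 1" "nu 1 2 4 = 1"
  "nu 1 3 0 = 1" "nu 1 3 1 = 4" "nu 1 3 2 = 4" "nu 1 3 3 = 2" "nu 1 3 4 = 4"
  "nu 1 4 0 = 3" "nu 1 4 1 = 3" "nu 1 4 2 = 2" "nu 1 4 3 = 1" "nu 1 4 4 = 1"
  "nu 2 0 0 = 3" "nu 2 0 1 = 2" "nu 2 0 2 = 2" "nu 2 0 3 = 4" "nu 2 0 4 = 4"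
  "nu 2 1 0 = 3" "nu 2 1 1 = 1" "nu 2 1 2 = 2" "nu 2 1 3 = 2" "nu 2 1 4 = 2"
  "nu 2 2 0 = 3" "nu 2 2 1 = 1" "nu 2 2 2 = 4" "nu 2 2 3 = 3" "nu 2 2 4 = 4"
  "nu 2 3 0 = 4" "nu 2 3 1 = 3" "nu 2 3 2 = 4" "nu 2 3 3 = 3" "nu 2 3 4 = 1"
  "nu 2 4 0 = 2" "nu 2 4 1 = 3" "nu 2 4 2 = 3" "nu 2 4 3 = 3" "nu 2 4 4 = 4"
  "nu 3 0 0 = 2" "nu 3 0 1 = 1" "nu 3 0 2 = 1" "nu 3 0 3 = 3" "nu 3 0 4 = 3"
  "nu 3 1 0 = 3" "nu 3 1 1 = 1" "nu 3 1 2 = 2" "nu 3 1 3 = 2" "nu 3 1 4 = 2"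
  "nu 3 2 0 = 1" "nu 3 2 1 = 4" "nu 3 2 2 = 2" "nu 3 2 3 = 1" "nu 3 2 4 = 2"
  "nu 3 3 0 = 2" "nu 3 3 1 = 1" "nu 3 3 2 = 2" "nu 3 3 3 = 1" "nu 3 3 4 = 4"
  "nu 3 4 0 = 2" "nu 3 4 1 = 3" "nu 3 4 2 = 3" "nu 3 4 3 = 3" "nu 3 4 4 = 4"
  "nu 4 0 0 = 4" "nu 4 0 1 = 2" "nu 4 0 2 = 1" "nu 4 0 3 = 2" "nu 4 0 4 = 1"
  "nu 4 1 0 = 2" "nu 4 1 1 = 4" "nu 4 1 2 = 4" "nu 4 1 3 = 3" "nu 4 1 4 = 2"
  "nu 4 2 0 = 4" "nu 4 2 1 = 1" "nu 4 2 2 = 3" "nu 4 2 3 = 1" "nu 4 2 4 = 1"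
  "nu 4 3 0 = 1" "nu 4 3 1 = 4" "nu 4 3 2 = 4" "nu 4 3 3 = 2" "nu 4 3 4 = 4"
  "nu 4 4 0 = 4" "nu 4 4 1 = 4" "nu 4 4 2 = 3" "nu 4 4 3 = 2" "nu 4 4 4 = 2"
    by (simp_all only: nu_def Let_def m n plus5 times5)
qed

lemma sgn5_eval:
  "sgn5 0 x = sgn x * (if \<bar>x\<bar> = 961 then 1 else -1)"
  "sgn5 1 x = sgn x * (if \<bar>x\<bar> = 13 \<or> \<bar>x\<bar> = 15 \<or> \<bar>x\<bar> = 43 \<or> \<bar>x\<bar> = 47 \<or> \<bar>x\<bar> = 49 \<or> \<bar>x\<bar> = 53 \<or> \<bar>x\<bar> = 57 \<or> \<bar>x\<bar> = 73
  \<or> \<bar>x\<bar> = 95 \<or> \<bar>x\<bar> = 107 \<or> \<bar>x\<bar> = 179 then 1 else -1)"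
  "sgn5 2 x = sgn x * (if \<bar>x\<bar> = 37 \<or> \<bar>x\<bar> = 41 \<or> \<bar>x\<bar> = 57 \<or> \<bar>x\<bar> = 69 \<or> \<bar>x\<bar> = 73 \<or> \<bar>x\<bar> = 83 \<or> \<bar>x\<bar> = 87 \<or> \<bar>x\<bar> = 101
  then 1 else -1)"
  "sgn5 3 x = sgn x * (if \<bar>x\<bar> = 5 \<or> \<bar>x\<bar> = 7 \<or> \<bar>x\<bar> = 21 \<or> \<bar>x\<bar> = 23 \<or> \<bar>x\<bar> = 35 \<or> \<bar>x\<bar> = 51 \<or> \<bar>x\<bar> = 55 \<or> \<bar>x\<bar> = 59 \<or>
  \<bar>x\<bar> = 65 \<or> \<bar>x\<bar> = 83 \<or> \<bar>x\<bar> = 105 \<or> \<bar>x\<bar> = 161 then 1 else -1)"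
  "sgn5 4 x = sgn x * (if \<bar>x\<bar> = 29 \<or> \<bar>x\<bar> = 31 \<or> \<bar>x\<bar> = 33 \<or> \<bar>x\<bar> = 53 \<or> \<bar>x\<bar> = 55 \<or> \<bar>x\<bar> = 59 \<or> \<bar>x\<bar> = 91 \<or> \<bar>x\<bar> = 103
  \<or> \<bar>x\<bar> = 107 \<or> \<bar>x\<bar> = 135 \<or> \<bar>x\<bar> = 183 then 1 else -1)"
  by (simp_all only: sgn5_def good_def distinct5 refl if_True if_False insert_iff empty_iff simp_thms)

lemma abs_sgn_int: "\<bar>numeral k :: int\<bar> = numeral k" "\<bar>- numeral k :: int\<bar> = numeral k"
  "\<bar>1 :: int\<bar> = 1" "\<bar>- 1 :: int\<bar> = 1"
  "sgn (numeral k :: int) = 1" "sgn (- numeral k :: int) = - 1" "sgn (1 :: int) = 1" "sgn (- 1 :: int) = - 1"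
  by simp_all

lemma line_state5: "line_state T \<alpha> \<beta> \<gamma> \<delta> = row T 1 \<alpha> \<beta> \<gamma> \<delta> (T (V 1 0 0 0 0 0) + 0)"
  by (simp add: line_state_def)

lemmas evaluate = line_state5 zero_state5 row5 plane_state5 onehot_plus line_sum_def sum5 plus5 times5
  plane_sign.simps nu5 sgn5_eval abs_sgn_int
  int_arith rel_simps if_True if_False simp_thms normalize5

text \<open>One line from each of the 29 orbits under the Singer cycle and the Frobenius map; that
  they suffice is established by \<open>all_zero\<close>. The last line is the subfield with 25
  elements, whose points have the exponents divisible by 651.\<close>

lemma line_sums_zero:
  "line_sum plane_sign (tab lab) 0 0 0 0 (line_state (tab lab) 0 0 0 0) = 0"
  "line_sum plane_sign (tab lab) 2 0 0 0 (line_state (tab lab) 2 0 0 0) = 0"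
  "line_sum plane_sign (tab lab) 1 0 0 0 (line_state (tab lab) 1 0 0 0) = 0"
  "line_sum plane_sign (tab lab) 4 4 0 0 (line_state (tab lab) 4 4 0 0) = 0"
  "line_sum plane_sign (tab lab) 0 0 4 1 (line_state (tab lab) 0 0 4 1) = 0"
  "line_sum plane_sign (tab lab) 2 3 0 0 (line_state (tab lab) 2 3 0 0) = 0"
  "line_sum plane_sign (tab lab) 0 2 2 4 (line_state (tab lab) 0 2 2 4) = 0"
  "line_sum plane_sign (tab lab) 3 0 1 1 (line_state (tab lab) 3 0 1 1) = 0"
  "line_sum plane_sign (tab lab) 3 4 0 3 (line_state (tab lab) 3 4 0 3) = 0"
  "line_sum plane_sign (tab lab) 3 4 2 0 (line_state (tab lab) 3 4 2 0) = 0"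
  "line_sum plane_sign (tab lab) 0 1 0 0 (line_state (tab lab) 0 1 0 0) = 0"
  "line_sum plane_sign (tab lab) 0 0 1 0 (line_state (tab lab) 0 0 1 0) = 0"
  "line_sum plane_sign (tab lab) 2 0 0 2 (line_state (tab lab) 2 0 0 2) = 0"
  "line_sum plane_sign (tab lab) 3 1 0 0 (line_state (tab lab) 3 1 0 0) = 0"
  "line_sum plane_sign (tab lab) 2 1 2 0 (line_state (tab lab) 2 1 2 0) = 0"
  "line_sum plane_sign (tab lab) 4 1 0 1 (line_state (tab lab) 4 1 0 1) = 0"
  "line_sum plane_sign (tab lab) 3 4 1 4 (line_state (tab lab) 3 4 1 4) = 0"
  "line_sum plane_sign (tab lab) 4 1 3 4 (line_state (tab lab) 4 1 3 4) = 0"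
  "line_sum plane_sign (tab lab) 4 0 0 0 (line_state (tab lab) 4 0 0 0) = 0"
  "line_sum plane_sign (tab lab) 0 0 4 4 (line_state (tab lab) 0 0 4 4) = 0"
  "line_sum plane_sign (tab lab) 4 3 3 0 (line_state (tab lab) 4 3 3 0) = 0"
  "line_sum plane_sign (tab lab) 3 3 0 0 (line_state (tab lab) 3 3 0 0) = 0"
  "line_sum plane_sign (tab lab) 4 4 0 4 (line_state (tab lab) 4 4 0 4) = 0"
  "line_sum plane_sign (tab lab) 4 2 0 2 (line_state (tab lab) 4 2 0 2) = 0"
  "line_sum plane_sign (tab lab) 2 4 0 3 (line_state (tab lab) 2 4 0 3) = 0"
  "line_sum plane_sign (tab lab) 1 2 4 3 (line_state (tab lab) 1 2 4 3) = 0"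
  "line_sum plane_sign (tab lab) 2 2 2 4 (line_state (tab lab) 2 2 2 4) = 0"
  "line_sum plane_sign (tab lab) 0 3 3 3 (line_state (tab lab) 0 3 3 3) = 0"
  "line_sum plane_sign (tab lab) 4 0 2 4 (line_state (tab lab) 4 0 2 4) = 0"
  by (simp_all only: evaluate table)

section \<open>The sign of a plane changes under the Singer cycle, q = 5\<close>

definition signs :: "'v set \<Rightarrow> int" where
  "signs U = plane_sign (sum lab (logs U))"

lemma act_add: "act (s + t) = act s + act t"
  by (cases s rule: act.cases; cases t rule: act.cases) (simp add: algebra_simps)

lemma act_sum: "finite A \<Longrightarrow> act (sum g A) = (\<Sum>i\<in>A. act (g i))"
  by (induction A rule: finite_induct) (simp_all add: act_add, simp add: zero_state5)

text \<open>The norm is multiplicative and \<delta> has norm 1, the constant coefficient in its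
  cubic relation.\<close>

lemma nu_act: "nu c (a + 4 * c) (b + 3 * c) = nu a b c"
  unfolding nu_def Let_def by algebra

lemma sgn5_minus: "sgn5 x (- y) = - sgn5 x y"
  by (simp add: sgn5_def)

text \<open>A shift exchanges even and odd residue classes and so negates the alternating sum of
  squares.\<close>

lemma plane_sign_act: "plane_sign (act s) = - plane_sign s"
proof (cases s rule: act.cases)
  case (1 c0 c1 c2 c3 c4 c5 a b c)
  have "c5 * c5 + c1 * c1 + c3 * c3 - (c0 * c0 + c2 * c2 + c4 * c4) =
      - (c0 * c0 + c2 * c2 + c4 * c4 - (c1 * c1 + c3 * c3 + c5 * c5))" by simp
  then show ?thesis unfolding 1 act.simps plane_sign.simps nu_act by (simp only: sgn5_minus)
qed

lemma signs_\<sigma>: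
  assumes "U \<in> sub 3"
  shows "signs (\<sigma> ` U) = - signs U"
proof -
  have "subspace U" using assms by (simp add: in_sub_iff)
  then have "sum lab (logs (\<sigma> ` U)) = act (sum lab (logs U))"
    using finite_subset[OF logs_subset[of U]] by (simp add: sum_logs_\<sigma> lab_Suc act_sum)
  then show ?thesis by (simp add: signs_def plane_sign_act)
qed

fun total :: "'k state5 \<Rightarrow> int" where
  "total (c0, c1, c2, c3, c4, c5, a, b, c) = c0 + c1 + c2 + c3 + c4 + c5"

lemma total_lab: "total (lab i) = 1"
proof -
  have "total (act s) = total s" for s by (cases s rule: act.cases) simp
  then show ?thesis unfolding lab_def by (induction i) (simp_all add: onehot_def)
qed

lemma total_sum: "finite A \<Longrightarrow> total (sum lab A) = int (card A)"
proof (induction A rule: finite_induct)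
  case (insert x A)
  have "total (s + t) = total s + total t" for s t by (cases s rule: act.cases; cases t rule: act.cases) simp
  with insert show ?case by (simp add: total_lab)
qed (simp add: zero_state5)

text \<open>Squares have the parity of their roots, so the alternating sum of squares is odd with
  \<open>total s\<close> and cannot vanish.\<close>

lemma abs_plane_sign: "odd (total s) \<Longrightarrow> \<bar>plane_sign s\<bar> = 1"
proof (cases s rule: act.cases)
  case (1 c0 c1 c2 c3 c4 c5 a b c)
  assume "odd (total s)"
  then have "odd (c0 * c0 + c2 * c2 + c4 * c4 - (c1 * c1 + c3 * c3 + c5 * c5))" by (auto simp: 1)
  then have "c0 * c0 + c2 * c2 + c4 * c4 - (c1 * c1 + c3 * c3 + c5 * c5) \<noteq> 0" by (metis even_zero)
  then show ?thesis by (simp add: 1 sgn5_def abs_mult)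
qed

lemma abs_signs:
  assumes "is_space q 6 scale" "U \<in> sub 3"
  shows "\<bar>signs U\<bar> = 1"
proof -
  have "card (logs U) = 31" using card_logs[OF assms] by (simp add: card5)
  then have "total (sum lab (logs U)) = 31"
    using total_sum[OF finite_subset[OF logs_subset[of U]]] by simp
  then show ?thesis unfolding signs_def by (intro abs_plane_sign) simp
qed

text \<open>The Frobenius map, which sends $x^i$ to $x^{5i}$; on states it becomes \<open>frob\<close>.\<close>

definition \<phi> :: "'v \<Rightarrow> 'v" where
  "\<phi> v = (case inv val v of V a b c d e f \<Rightarrow>
    a *s pt 0 + (b *s pt 5 + (c *s pt 10 + (d *s pt 15 + (e *s pt 20 + f *s pt 25)))))"

lemma \<phi>_val: "\<phi> (val (V a b c d e f)) =
    a *s pt 0 + (b *s pt 5 + (c *s pt 10 + (d *s pt 15 + (e *s pt 20 + f *s pt 25))))"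
  using bij_val by (simp add: \<phi>_def bij_def)

lemma linear_\<phi>: "Vector_Spaces.linear scale scale \<phi>"
  unfolding linear_iff
proof (intro conjI allI)
  fix x y show "\<phi> (x + y) = \<phi> x + \<phi> y"
    by (cases x rule: val_cases, cases y rule: val_cases)
      (simp add: \<phi>_val val_add scale_left_distrib ac_simps)
next
  fix c x show "\<phi> (c *s x) = c *s \<phi> x"
    by (cases x rule: val_cases) (simp add: \<phi>_val val_scale scale_right_distrib)
qed unfold_locales

text \<open>The fifth power of the relation x^6 = x + 3. It is what makes \<open>\<phi>\<close>
  compatible with reduction of x^6.\<close>

lemma pt_30: "pt 30 = 3 *s pt 0 + pt 5"
proof -
  have "(st ^^ 30) (V 1 0 0 0 0 0) = V 3 0 0 0 0 1" "(st ^^ 5) (V 1 0 0 0 0 0) = V 0 0 0 0 0 1"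
    by (simp_all only: funpow_numeral_swap funpow_one st5 plus5 times5 pred_numeral_simps BitM.simps numeral_One
      funpow.simps(1) id_apply)
  then show ?thesis by (simp add: pt_def val_scale val_add)
qed

lemma \<phi>_\<sigma>: "\<phi> (\<sigma> x) = (\<sigma> ^^ 5) (\<phi> x)"
proof (cases x rule: val_cases)
  fix a b c d e f assume x: "x = val (V a b c d e f)"
  have add: "(\<sigma> ^^ 5) (u + v) = (\<sigma> ^^ 5) u + (\<sigma> ^^ 5) v" for u v
    using linear_\<sigma>_pow[of 5] unfolding linear_iff by blast
  show ?thesis
    unfolding x \<sigma>_val st5 \<phi>_val add \<sigma>_pow_scale \<sigma>_pow_pt
    by (simp add: pt_30 scale_left_distrib scale_right_distrib mult.commute ac_simps)
qed

lemma \<phi>_pt: "\<phi> (pt i) = pt (5 * i)"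
proof (induction i)
  case 0
  show ?case using \<phi>_val[of 1 0 0 0 0 0] by (simp add: pt_def)
next
  case (Suc i)
  then show ?case using \<phi>_\<sigma>[of "pt i"] \<sigma>_pow_pt[of 5 "5 * i"] by (simp add: \<sigma>_pt)
qed

text \<open>A nonzero vector is a multiple of some x^i, and its image is the same multiple of
  x^(5i).\<close>

lemma inj_\<phi>: "inj \<phi>"
proof -
  interpret g: Vector_Spaces.linear scale scale \<phi> by (rule linear_\<phi>)
  show ?thesis unfolding g.inj_iff_eq_0
  proof (intro allI impI, rule ccontr)
    fix v assume v: "\<phi> v = 0" "v \<noteq> 0"
    then obtain i c where "c \<noteq> 0" "v = c *s pt i" by (auto elim: pt_cases)
    then show False using v by (simp add: g.scale \<phi>_pt)
  qed
qed

text \<open>Multiplication by 5 is negation modulo 6, which permutes the counts. The other entries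
  express \<delta>^5 = 3 + 2\<delta>^2 and \<delta>^10 = 1 + 2\<delta> + 4\<delta>^2.\<close>

fun frob :: "'k state5 \<Rightarrow> 'k state5" where
  "frob (c0, c1, c2, c3, c4, c5, a, b, c) = (c0, c5, c4, c3, c2, c1, a + 3 * b + 1 * c, 2 * c, 2 * b + 4 * c)"

lemma frob_add: "frob (s + t) = frob s + frob t"
  by (cases s rule: act.cases; cases t rule: act.cases) (simp add: algebra_simps)

lemma frob_sum: "finite A \<Longrightarrow> frob (sum g A) = (\<Sum>i\<in>A. frob (g i))"
  by (induction A rule: finite_induct) (simp_all add: frob_add, simp add: zero_state5)

text \<open>The norm is invariant under field automorphisms; here all 125 triples are
  checked.\<close>

lemma nu_frob: "nu (a + 3 * b + 1 * c) (2 * c) (2 * b + 4 * c) = nu a b c"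
proof -
  have "\<forall>a b c. nu (a + 3 * b + 1 * c) (2 * c) (2 * b + 4 * c) = nu a b c"
    by (simp only: all5 plus5 times5 nu5 simp_thms)
  then show ?thesis by blast
qed

lemma plane_sign_frob: "plane_sign (frob s) = plane_sign s"
proof (cases s rule: act.cases)
  case (1 c0 c1 c2 c3 c4 c5 a b c)
  have "c0 * c0 + c4 * c4 + c2 * c2 - (c5 * c5 + c3 * c3 + c1 * c1) =
      c0 * c0 + c2 * c2 + c4 * c4 - (c1 * c1 + c3 * c3 + c5 * c5)" by simp
  then show ?thesis unfolding 1 frob.simps plane_sign.simps nu_frob by (simp only:)
qed

text \<open>The fifth power of a product with \<delta> gains the factor \<delta>^5.\<close>

lemma frob_act: "frob (act s) = (act ^^ 5) (frob s)"
proof (cases s rule: act.cases)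
  case (1 c0 c1 c2 c3 c4 c5 a b c)
  have "\<forall>a b c. frob (act (c0, c1, c2, c3, c4, c5, a, b, c)) = (act ^^ 5) (frob (c0, c1, c2, c3, c4, c5, a, b, c))"
    by (simp only: all5 act.simps frob.simps funpow_numeral_swap funpow_one pred_numeral_simps BitM.simps numeral_One
      plus5 times5 simp_thms)
  then show ?thesis unfolding 1 by blast
qed

lemma frob_lab: "frob (lab i) = lab (5 * i)"
proof (induction i)
  case 0
  show ?case by (simp add: lab_0 onehot_def)
next
  case (Suc i)
  have "frob (lab (Suc i)) = (act ^^ 5) (frob (lab i))" by (simp add: frob_act lab_def)
  also have "\<dots> = lab (5 + 5 * i)" by (simp only: Suc) (simp only: lab_def funpow_add o_apply)
  finally show ?case by simp
qed

lemma signs_\<phi>: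
  assumes "U \<in> sub 3"
  shows "signs (\<phi> ` U) = signs U"
proof -
  have s: "subspace U" using assms by (simp add: in_sub_iff)
  have "inj_on (\<lambda>i. 5 * i mod 3906) {..<3906::nat}"
  \<comment> \<open>3125 inverts 5 modulo 3906, because 5^6 = 15625 = 4 * 3906 + 1.\<close>
  proof (rule inj_on_inverseI[where g = "\<lambda>i. 3125 * i mod 3906"])
    fix x :: nat assume "x \<in> {..<3906}"
    moreover have "3125 * (5 * x mod 3906) mod 3906 = (x + 3906 * (4 * x)) mod 3906"
      by (simp add: mod_mult_right_eq)
    moreover have "\<dots> = x mod 3906" by (rule mod_mult_self2)
    ultimately show "3125 * (5 * x mod 3906) mod 3906 = x" by simp
  qed
  then have i: "inj_on (\<lambda>i. 5 * i mod 3906) (logs U)" by (rule inj_on_subset[OF _ logs_subset])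
  have "logs (\<phi> ` U) = (\<lambda>i. 5 * i mod 3906) ` logs U"
    using logs_image[OF linear_\<phi>, of "\<lambda>i. 5 * i"] \<phi>_pt s by simp
  then have "sum lab (logs (\<phi> ` U)) = frob (sum lab (logs U))"
    using finite_subset[OF logs_subset[of U]] i by (simp add: sum.reindex lab_mod frob_sum frob_lab)
  then show ?thesis by (simp add: signs_def plane_sign_frob)
qed

text \<open>The Frobenius map fixes the point 0, sends the point \<open>d\<close> to
  \<open>5 * d\<close>, and preserves signs.\<close>

lemma zero_at_times5: "zero_at signs d \<Longrightarrow> zero_at signs (5 * d mod 3906)"
proof -
  interpret g: Vector_Spaces.linear scale scale \<phi> by (rule linear_\<phi>)
  have "span {pt 0, pt (5 * d)} = \<phi> ` span {pt 0, pt d}"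
    using g.span_image[of "{pt 0, pt d}"] by (simp add: \<phi>_pt)
  moreover assume "zero_at signs d"
  ultimately show ?thesis
    using fsum_image[OF linear_\<phi> inj_\<phi>, where f = signs and \<epsilon> = 1] signs_\<phi>
    by (simp add: zero_at_def span_pts_mod)
qed

section \<open>Differences of logarithms on the checked lines, q = 5\<close>

lemma id_Suc: "i < 3906 \<Longrightarrow> Suc i mod 3906 = (if i = 3905 then 0 else i + 1)"
  by auto

lemmas log_table_raw = blocks_tab[where lab = "\<lambda>i. i" and nx = "\<lambda>i. if i = 3905 then 0 else i + 1" and k = 62
  and m = 63, OF id_Suc]

lemmas log_blocks = log_table_raw[simplified blocks_one blocks_numeral blocks.simps funpow_numeral_swap
  funpow_one funpow.simps(1)
  id_apply st5 plus5 times5 pred_numeral_simps BitM.simps numeral_One simp_thms if_False if_True rel_simps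
  nat_arith]

lemmas log_table = log_blocks[simplified runs_numeral runs_one normalize5 st5 plus5 times5 pred_numeral_simps
  BitM.simps numeral_One
  simp_thms if_False if_True rel_simps nat_arith]

text \<open>Unfolded for \<open>k = 6\<close>, this lists the whole Frobenius orbit of
  \<open>d\<close>, since 5^6 is 1 modulo 3906.\<close>

primrec orbit_zero :: "nat \<Rightarrow> nat \<Rightarrow> bool" where
  "orbit_zero 0 d = True"
| "orbit_zero (Suc k) d = (zero_at signs d \<and> orbit_zero k (5 * d mod 3906))"

lemma orbit_zeroI: "zero_at signs d \<Longrightarrow> orbit_zero k d"
  by (induction k arbitrary: d) (auto simp: zero_at_times5)

definition codes :: "'k \<Rightarrow> 'k \<Rightarrow> 'k \<Rightarrow> 'k \<Rightarrow> 'k vec6 list" where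
  "codes \<alpha> \<beta> \<gamma> \<delta> = [V 1 0 0 0 0 0, V 0 1 \<alpha> \<beta> \<gamma> \<delta>, V 1 1 \<alpha> \<beta> \<gamma> \<delta>,
    V 2 1 \<alpha> \<beta> \<gamma> \<delta>, V 3 1 \<alpha> \<beta> \<gamma> \<delta>, V 4 1 \<alpha> \<beta> \<gamma> \<delta>]"

lemma codes_line:
  "v \<in> set (codes \<alpha> \<beta> \<gamma> \<delta>) \<Longrightarrow> val v \<in> line \<alpha> \<beta> \<gamma> \<delta> \<and> v \<noteq> V 0 0 0 0 0 0"
  unfolding codes_def by (auto simp: in_line_iff)

definition points :: "'k \<Rightarrow> 'k \<Rightarrow> 'k \<Rightarrow> 'k \<Rightarrow> nat list" where
  "points \<alpha> \<beta> \<gamma> \<delta> = map (tab (\<lambda>i. i)) (codes \<alpha> \<beta> \<gamma> \<delta>)"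

lemma points_eq:
  "points 0 0 0 0 = [0, 1, 156, 31, 6, 781]"
  "points 2 0 0 0 = [0, 7, 2751, 1562, 535, 187]"
  "points 1 0 0 0 = [0, 157, 1331, 1047, 812, 12]"
  "points 4 4 0 0 = [0, 13, 1093, 3247, 1700, 1652]"
  "points 0 0 4 1 = [0, 2193, 1922, 2627, 16, 1591]"
  "points 2 3 0 0 = [0, 977, 18, 691, 2416, 2820]"
  "points 0 2 2 4 = [0, 3638, 2808, 353, 21, 1640]"
  "points 3 0 1 1 = [0, 3725, 22, 2490, 1144, 595]"
  "points 3 4 0 3 = [0, 3230, 460, 2442, 606, 23]"
  "points 3 4 2 0 = [0, 969, 930, 24, 1324, 2378]"
  "points 0 1 0 0 = [0, 38, 2327, 1132, 1828, 3509]"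
  "points 0 0 1 0 = [0, 1826, 645, 2159, 41, 2905]"
  "points 2 0 0 2 = [0, 42, 613, 1993, 2540, 1756]"
  "points 3 1 0 0 = [0, 1563, 2766, 3238, 43, 365]"
  "points 2 1 2 0 = [0, 44, 2135, 1739, 2309, 140]"
  "points 4 1 0 1 = [0, 1912, 635, 2100, 51, 456]"
  "points 3 4 1 4 = [0, 2840, 2187, 3818, 54, 1308]"
  "points 4 1 3 4 = [0, 2519, 57, 685, 3259, 3452]"
  "points 4 0 0 0 = [0, 782, 62, 162, 976, 1669]"
  "points 0 0 4 4 = [0, 2256, 1130, 3164, 66, 3236]"
  "points 4 3 3 0 = [0, 542, 3370, 374, 78, 407]"
  "points 3 3 0 0 = [0, 1048, 2195, 2757, 990, 93]"
  "points 4 4 0 4 = [0, 848, 1184, 3470, 101, 585]"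
  "points 4 2 0 2 = [0, 112, 2530, 1510, 248, 3589]"
  "points 2 4 0 3 = [0, 123, 1891, 1283, 2120, 1642]"
  "points 1 2 4 3 = [0, 2646, 756, 1638, 126, 504]"
  "points 2 2 2 4 = [0, 2214, 3317, 3693, 2741, 128]"
  "points 0 3 3 3 = [0, 2457, 297, 1264, 1760, 1971]"
  "points 4 0 2 4 = [0, 1953, 2604, 651, 3255, 1302]"
  by (simp_all only: points_def codes_def list.map log_table normalize5 plus5 times5)

text \<open>One vanishing line sum settles the differences of all ordered pairs of points on that
  line, together with their Frobenius images.\<close>

lemma points_zero:
  assumes "line_sum plane_sign (tab lab) \<alpha> \<beta> \<gamma> \<delta> (line_state (tab lab) \<alpha> \<beta> \<gamma> \<delta>) = 0"
  shows "list_all (\<lambda>a. list_all (\<lambda>c. a = c \<or> orbit_zero 6 ((c + 3906 - a) mod 3906)) (points \<alpha> \<beta> \<gamma> \<delta>))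
    (points \<alpha> \<beta> \<gamma> \<delta>)"
proof -
  have z: "fsum signs (line \<alpha> \<beta> \<gamma> \<delta>) = 0"
    using fsum_line_eq[of plane_sign lab \<alpha> \<beta> \<gamma> \<delta>] assms by (simp add: signs_def[abs_def])
  show ?thesis unfolding list_all_iff
  proof (intro ballI, rule disjCI, rule ccontr)
    fix a c assume "a \<in> set (points \<alpha> \<beta> \<gamma> \<delta>)" "c \<in> set (points \<alpha> \<beta> \<gamma> \<delta>)" "a \<noteq> c"
      and n: "\<not> orbit_zero 6 ((c + 3906 - a) mod 3906)"
    then obtain v w where v: "v \<in> set (codes \<alpha> \<beta> \<gamma> \<delta>)" "w \<in> set (codes \<alpha> \<beta> \<gamma> \<delta>)"
      and a: "a = lg (val v)" "c = lg (val w)" "lg (val v) \<noteq> lg (val w)"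
      unfolding points_def set_map tab_def by blast
    have "zero_at signs ((lg (val w) + 3906 - lg (val v)) mod 3906)"
      by (rule line_points_zero_at[where f = signs, OF signs_\<sigma> z]) (use codes_line v a(3) in simp_all)
    then show False using n unfolding a(1,2) by (simp add: orbit_zeroI)
  qed
qed

lemma orbit_zero_numeral:
  "orbit_zero (numeral k) d = (zero_at signs d \<and> orbit_zero (pred_numeral k) (5 * d mod 3906))"
  "orbit_zero 1 d = zero_at signs d"
  by (simp_all only: numeral_eq_Suc[of k] One_nat_def orbit_zero.simps simp_thms)

lemmas zeros = line_sums_zero[THEN points_zero, simplified points_eq list.pred_inject refl rel_simps
  simp_thms orbit_zero_numeral pred_numeral_simps BitM.simps numeral_One, simplified]

text \<open>The differences collected in \<open>zeros\<close> exhaust 1, ..., 3905. The walk begins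
  at \<open>Suc 0\<close> because full simplification has put the number 1 into this form in
  \<open>zeros\<close>.\<close>

lemma all_zero: "avoids (\<lambda>d. \<not> zero_at signs d) (\<lambda>d. d + 1) 3905 (Suc 0)"
proof -
  have "Suc 0 + 1 = 2" by simp
  then show ?thesis
    by (simp only: zeros avoids_numeral avoids_one if_False simp_thms pred_numeral_simps BitM.simps numeral_One
      nat_arith)
qed

lemma zero_at_signs: "0 < d \<Longrightarrow> d < 3906 \<Longrightarrow> zero_at signs d"
proof -
  assume d: "0 < d" "d < 3906"
  have "((\<lambda>d. d + 1) ^^ i) (Suc 0) = Suc i" for i :: nat by (induction i) auto
  then show ?thesis using avoidsD[OF all_zero, of "d - 1"] d by simp
qed

lemma halving_5:
  assumes "is_space q 6 scale"
  shows "(\<exists>\<L>. large_set q 2 2 3 6 scale \<L>) \<and> (\<exists>\<B>. subspace_design q 2 6 3 78 scale \<B>)"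
proof (rule halving[where f = signs, OF assms])
  fix T assume T: "T \<in> sub 2"
  show "(\<Sum>U | U \<in> sub 3 \<and> T \<subseteq> U. signs U) = 0"
    using fsum_eq_0_if_zero_at[where f = signs, OF signs_\<sigma> zero_at_signs T] by (simp add: fsum_def)
  show "card {U \<in> sub 3. T \<subseteq> U} = 2 * 78"
    using card_over_sub2[OF assms T] by (simp add: card5)
qed (use abs_signs[OF assms] line_in_sub in auto)

end

subsection \<open>The field with three elements\<close>

locale space3 = coordinates scale val
  for scale :: "'k::{field,finite} \<Rightarrow> 'v::{ab_group_add,finite} \<Rightarrow> 'v" (infixr "*s" 75)
    and val :: "'k vec6 \<Rightarrow> 'v" +
  assumes card3: "CARD('k) = 3"
begin

lemma three: "(3 :: 'k) = 0"
  using of_nat_card_eq_0[where 'k = 'k] card3 by simp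

lemma four: "(4 :: 'k) = 1"
proof -
  have "(4 :: 'k) = 3 + 1" by simp
  then show ?thesis by (simp only: three) simp
qed

lemma plus3:
  "(0 :: 'k) + 0 = 0" "(0 :: 'k) + 1 = 1" "(0 :: 'k) + 2 = 2"
  "(1 :: 'k) + 0 = 1" "(1 :: 'k) + 1 = 2" "(1 :: 'k) + 2 = 0"
  "(2 :: 'k) + 0 = 2" "(2 :: 'k) + 1 = 0" "(2 :: 'k) + 2 = 1"
  by (simp_all add: three four)

lemma times3:
  "(0 :: 'k) * 0 = 0" "(0 :: 'k) * 1 = 0" "(0 :: 'k) * 2 = 0"
  "(1 :: 'k) * 0 = 0" "(1 :: 'k) * 1 = 1" "(1 :: 'k) * 2 = 2"
  "(2 :: 'k) * 0 = 0" "(2 :: 'k) * 1 = 2" "(2 :: 'k) * 2 = 1"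
  by (simp_all add: three four)

lemma distinct3:
  "((0 :: 'k) = 1) = False" "((0 :: 'k) = 2) = False" "((1 :: 'k) = 0) = False" "((1 :: 'k) = 2) = False"
  "((2 :: 'k) = 0) = False" "((2 :: 'k) = 1) = False"
proof -
  have "(2 :: 'k) \<noteq> 0"
  proof
    assume "(2 :: 'k) = 0"
    moreover have "(3 :: 'k) = 2 + 1" by simp
    ultimately show False using three by simp
  qed
  moreover have "(2 :: 'k) \<noteq> 1"
  proof
    assume "(2 :: 'k) = 1"
    moreover have "(2 :: 'k) = 1 + 1" by simp
    ultimately show False by (metis add_cancel_right_right zero_neq_one)
  qed
  ultimately show
    "((0 :: 'k) = 1) = False" "((0 :: 'k) = 2) = False" "((1 :: 'k) = 0) = False" "((1 :: 'k) = 2) = False"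
    "((2 :: 'k) = 0) = False" "((2 :: 'k) = 1) = False" by auto
qed

lemma UNIV3: "(UNIV :: 'k set) = {0, 1, 2}"
proof -
  have "card {0, 1, 2 :: 'k} = 3" by (simp add: distinct3)
  then show ?thesis using card3 card_subset_eq[of "UNIV :: 'k set" "{0, 1, 2}"] by simp
qed

lemma sum3: "(\<Sum>a\<in>UNIV. g a) = g 0 + (g 1 + g (2 :: 'k))"
  unfolding UNIV3 by (simp add: distinct3)

text \<open>\<open>x\<close> has order $364 = (3^6 - 1) / 2$ modulo scalars in the field defined by $x^6 - x^5 - 1$.\<close>

sublocale lfsr scale val 1 0 1
  by unfold_locales simp

lemma st3: "st (V a b c d e f) = V f a b c d (e + f)"
  by simp

lemma avoids_axis: "avoids on_axis st 363 (st (V 1 0 0 0 0 0))"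
  by (simp only: avoids_numeral avoids.simps st3 on_axis_iff plus3 times3 distinct3 simp_thms if_True if_False
    pred_numeral_simps BitM.simps refl)

text \<open>The scalar is again the norm of x, the constant term -1 = 2 of the defining
  polynomial.\<close>

lemma st_364: "(st ^^ 364) (V 1 0 0 0 0 0) = V 2 0 0 0 0 0"
  by (simp only: funpow_numeral_swap funpow_one st3 plus3 times3 pred_numeral_simps BitM.simps numeral_One)

sublocale singer scale val 1 0 1 364
proof
  fix i c assume i: "0 < i" "i < (364 :: nat)"
  then obtain j where j: "i = Suc j" by (cases i) auto
  have "\<not> on_axis ((st ^^ j) (st (V 1 0 0 0 0 0)))"
    using avoidsD[OF avoids_axis, of j] i j by simp
  then show "(st ^^ i) (V 1 0 0 0 0 0) \<noteq> V c 0 0 0 0 0"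
    by (auto simp: j funpow_swap1 on_axis_def)
qed (auto simp: card3 st_364)

text \<open>$118 = 2^{-2}$ modulo 157.\<close>

fun act :: "int \<times> int \<times> int \<Rightarrow> int \<times> int \<times> int" where
  "act (e, s, t) = (- e, 2 * s mod 157, 118 * t mod 157)"

text \<open>All 52 transitions are tabulated, so that later rewriting need not reduce modulo
  157.\<close>

lemma act_cycle:
  "act (1, 1, 1) = (-1, 2, 118)" "act (-1, 2, 118) = (1, 4, 108)"
  "act (1, 4, 108) = (-1, 8, 27)" "act (-1, 8, 27) = (1, 16, 46)"
  "act (1, 16, 46) = (-1, 32, 90)" "act (-1, 32, 90) = (1, 64, 101)"
  "act (1, 64, 101) = (-1, 128, 143)" "act (-1, 128, 143) = (1, 99, 75)"
  "act (1, 99, 75) = (-1, 41, 58)" "act (-1, 41, 58) = (1, 82, 93)"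
  "act (1, 82, 93) = (-1, 7, 141)" "act (-1, 7, 141) = (1, 14, 153)"
  "act (1, 14, 153) = (-1, 28, 156)" "act (-1, 28, 156) = (1, 56, 39)"
  "act (1, 56, 39) = (-1, 112, 49)" "act (-1, 112, 49) = (1, 67, 130)"
  "act (1, 67, 130) = (-1, 134, 111)" "act (-1, 134, 111) = (1, 111, 67)"
  "act (1, 111, 67) = (-1, 65, 56)" "act (-1, 65, 56) = (1, 130, 14)"
  "act (1, 130, 14) = (-1, 103, 82)" "act (-1, 103, 82) = (1, 49, 99)"
  "act (1, 49, 99) = (-1, 98, 64)" "act (-1, 98, 64) = (1, 39, 16)"
  "act (1, 39, 16) = (-1, 78, 4)" "act (-1, 78, 4) = (1, 156, 1)"
  "act (1, 156, 1) = (-1, 155, 118)" "act (-1, 155, 118) = (1, 153, 108)"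
  "act (1, 153, 108) = (-1, 149, 27)" "act (-1, 149, 27) = (1, 141, 46)"
  "act (1, 141, 46) = (-1, 125, 90)" "act (-1, 125, 90) = (1, 93, 101)"
  "act (1, 93, 101) = (-1, 29, 143)" "act (-1, 29, 143) = (1, 58, 75)"
  "act (1, 58, 75) = (-1, 116, 58)" "act (-1, 116, 58) = (1, 75, 93)"
  "act (1, 75, 93) = (-1, 150, 141)" "act (-1, 150, 141) = (1, 143, 153)"
  "act (1, 143, 153) = (-1, 129, 156)" "act (-1, 129, 156) = (1, 101, 39)"
  "act (1, 101, 39) = (-1, 45, 49)" "act (-1, 45, 49) = (1, 90, 130)"
  "act (1, 90, 130) = (-1, 23, 111)" "act (-1, 23, 111) = (1, 46, 67)"
  "act (1, 46, 67) = (-1, 92, 56)" "act (-1, 92, 56) = (1, 27, 14)"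
  "act (1, 27, 14) = (-1, 54, 82)" "act (-1, 54, 82) = (1, 108, 99)"
  "act (1, 108, 99) = (-1, 59, 64)" "act (-1, 59, 64) = (1, 118, 16)"
  "act (1, 118, 16) = (-1, 79, 4)" "act (-1, 79, 4) = (1, 1, 1)"
  by simp_all

definition lab :: "nat \<Rightarrow> int \<times> int \<times> int" where
  "lab i = (act ^^ i) (1, 1, 1)"

lemma lab_0: "lab 0 = (1, 1, 1)"
  by (simp add: lab_def)

text \<open>52 is the order of 2 modulo 157 and is even, so the alternating sign returns as well;
  364 = 7 * 52.\<close>

lemma lab_52: "lab 52 = (1, 1, 1)"
  unfolding lab_def
  by (simp only: funpow_numeral_swap funpow_one act_cycle pred_numeral_simps BitM.simps numeral_One)

lemma lab_add: "lab (i + 52 * k) = lab i"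
proof (induction k)
  case (Suc k)
  have e: "i + 52 * Suc k = (i + 52 * k) + 52" by simp
  have "lab (i + 52 * Suc k) = (act ^^ (i + 52 * k)) (lab 52)"
    unfolding e lab_def funpow_add o_apply by (rule refl)
  also have "\<dots> = lab (i + 52 * k)" by (simp only: lab_52) (simp only: lab_def)
  finally show ?case using Suc by simp
qed simp

lemma lab_mod: "lab (i mod 364) = lab i"
proof -
  have "lab (i mod 364) = lab (i mod 364 + 52 * (7 * (i div 364)))" by (simp only: lab_add)
  also have "i mod 364 + 52 * (7 * (i div 364)) = i" by simp
  finally show ?thesis .
qed

lemma lab_Suc: "lab (Suc i mod 364) = act (lab i)"
  unfolding lab_mod by (simp add: lab_def)

lemmas normalize3 = normalize_lead[OF times3(9)]

lemmas table_blocks = blocks_tab[where lab = lab and nx = act and k = 52 and m = 7, OF lab_Suc, unfolded lab_0,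
  simplified blocks_numeral blocks_one funpow_numeral_swap funpow_one act_cycle st3 plus3 times3
    pred_numeral_simps BitM.simps
  numeral_One simp_thms]

lemmas table = table_blocks[simplified runs_numeral runs_one act_cycle normalize3 st3 plus3 times3
  pred_numeral_simps BitM.simps numeral_One simp_thms]

lemma row3: "row T b w x y z s = T (V 0 b w x y z) + (T (V 1 b w x y z) + (T (V 2 b w x y z) + s))"
  by (simp add: row_def sum3 add.assoc)

lemma plane_state3: "plane_state T \<alpha> \<beta> \<gamma> \<delta> w x y z s =
  row T 0 w x y z (row T 1 (\<alpha> + w) (\<beta> + x) (\<gamma> + y) (\<delta> + z)
    (row T 2 (2 * \<alpha> + w) (2 * \<beta> + x) (2 * \<gamma> + y) (2 * \<delta> + z) s))"
  unfolding plane_state_def row_def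
    sum3[of "\<lambda>b. \<Sum>a\<in>UNIV. T (V a b (b * \<alpha> + w) (b * \<beta> + x) (b * \<gamma> + y) (b * \<delta> + z))"]
  by (simp add: add.assoc)

lemma zero_state3: "0 = (0 :: int, 0 :: int, 0 :: int)"
  by (simp add: zero_prod_def)

text \<open>Indexed by |E|, with the residues of \<open>S\<^sup>2 T\<close> that receive the sign 1.
  For example, |E| = 13 with residue 0 occurs for the subfield with 27 elements: its exponents are
  the multiples of 28, and the 13 powers of 2 are the 13th roots of unity modulo 157, with sum
  0.\<close>

definition good :: "int \<Rightarrow> int set" where
  "good x = (if x = 1 then {4, 13, 35, 46, 71, 89, 92, 95, 100, 101, 104, 108, 123, 127, 147, 150}
    else if x = 3 then {9, 30, 33, 52, 69, 73, 80, 87, 120, 148}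
    else if x = 5 then {32, 62, 72, 98, 119, 122, 128}
    else if x = 7 then {34}
    else if x = 9 then {73, 129, 154}
    else if x = 13 then {0}
    else {})"

fun plane_sign :: "int \<times> int \<times> int \<Rightarrow> int" where
  "plane_sign (e, s, t) = sgn e * (if s * s * t mod 157 \<in> good \<bar>e\<bar> then 1 else -1)"

lemma pair_plus: "(e, s, t) + (e', s', t') = (e + e', s + s', t + t')" for e s t e' s' t' :: int
  by simp

text \<open>Here each of the 31 orbits of the Singer cycle itself has a representative. The orbit of
  the subfield with 9 elements has length 91 and is represented by \<open>0 1 2 2\<close>.\<close>

lemma line_sums_zero:
  "line_sum plane_sign (tab lab) 0 0 0 0 (line_state (tab lab) 0 0 0 0) = 0"
  "line_sum plane_sign (tab lab) 0 0 0 1 (line_state (tab lab) 0 0 0 1) = 0"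
  "line_sum plane_sign (tab lab) 1 0 0 1 (line_state (tab lab) 1 0 0 1) = 0"
  "line_sum plane_sign (tab lab) 1 1 0 1 (line_state (tab lab) 1 1 0 1) = 0"
  "line_sum plane_sign (tab lab) 1 1 1 1 (line_state (tab lab) 1 1 1 1) = 0"
  "line_sum plane_sign (tab lab) 1 1 1 2 (line_state (tab lab) 1 1 1 2) = 0"
  "line_sum plane_sign (tab lab) 1 1 1 0 (line_state (tab lab) 1 1 1 0) = 0"
  "line_sum plane_sign (tab lab) 2 2 2 2 (line_state (tab lab) 2 2 2 2) = 0"
  "line_sum plane_sign (tab lab) 0 2 1 0 (line_state (tab lab) 0 2 1 0) = 0"
  "line_sum plane_sign (tab lab) 2 0 1 2 (line_state (tab lab) 2 0 1 2) = 0"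
  "line_sum plane_sign (tab lab) 0 0 1 0 (line_state (tab lab) 0 0 1 0) = 0"
  "line_sum plane_sign (tab lab) 0 0 1 1 (line_state (tab lab) 0 0 1 1) = 0"
  "line_sum plane_sign (tab lab) 1 0 0 2 (line_state (tab lab) 1 0 0 2) = 0"
  "line_sum plane_sign (tab lab) 1 1 0 2 (line_state (tab lab) 1 1 0 2) = 0"
  "line_sum plane_sign (tab lab) 2 2 2 1 (line_state (tab lab) 2 2 2 1) = 0"
  "line_sum plane_sign (tab lab) 1 2 2 0 (line_state (tab lab) 1 2 2 0) = 0"
  "line_sum plane_sign (tab lab) 2 0 1 0 (line_state (tab lab) 2 0 1 0) = 0"
  "line_sum plane_sign (tab lab) 2 1 0 2 (line_state (tab lab) 2 1 0 2) = 0"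
  "line_sum plane_sign (tab lab) 1 0 2 1 (line_state (tab lab) 1 0 2 1) = 0"
  "line_sum plane_sign (tab lab) 0 0 1 2 (line_state (tab lab) 0 0 1 2) = 0"
  "line_sum plane_sign (tab lab) 2 0 0 0 (line_state (tab lab) 2 0 0 0) = 0"
  "line_sum plane_sign (tab lab) 1 2 0 0 (line_state (tab lab) 1 2 0 0) = 0"
  "line_sum plane_sign (tab lab) 0 0 0 2 (line_state (tab lab) 0 0 0 2) = 0"
  "line_sum plane_sign (tab lab) 1 2 1 0 (line_state (tab lab) 1 2 1 0) = 0"
  "line_sum plane_sign (tab lab) 2 2 1 2 (line_state (tab lab) 2 2 1 2) = 0"
  "line_sum plane_sign (tab lab) 2 0 2 2 (line_state (tab lab) 2 0 2 2) = 0"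
  "line_sum plane_sign (tab lab) 0 2 0 2 (line_state (tab lab) 0 2 0 2) = 0"
  "line_sum plane_sign (tab lab) 0 1 2 2 (line_state (tab lab) 0 1 2 2) = 0"
  "line_sum plane_sign (tab lab) 1 0 1 1 (line_state (tab lab) 1 0 1 1) = 0"
  "line_sum plane_sign (tab lab) 0 2 2 2 (line_state (tab lab) 0 2 2 2) = 0"
  "line_sum plane_sign (tab lab) 2 2 2 0 (line_state (tab lab) 2 2 2 0) = 0"
  by (simp_all only: line_state_def zero_state3 row3 plane_state3 pair_plus line_sum_def sum3 plus3 times3 table
    normalize3
    int_arith, simp_all add: good_def)

section \<open>The sign of a plane changes under the Singer cycle, q = 3\<close>

definition signs :: "'v set \<Rightarrow> int" where
  "signs U = plane_sign (sum lab (logs U))"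

text \<open>\<open>act\<close> reduces every label modulo 157, whereas sums of labels are plain
  integers. It therefore commutes with sums only up to congruence, which is enough for
  \<open>plane_sign\<close>.\<close>

lemma sum_act:
  assumes "finite A" "sum g A = (e, s, t)"
  shows "\<exists>s' t'. (\<Sum>i\<in>A. act (g i)) = (- e, s', t') \<and> s' mod 157 = 2 * s mod 157 \<and> t' mod 157 = 118 * t mod 157"
  using assms
proof (induction A arbitrary: e s t rule: finite_induct)
  case empty
  then show ?case by (simp add: zero_state3)
next
  case (insert x A)
  obtain e0 s0 t0 where g: "g x = (e0, s0, t0)" by (cases "g x")
  obtain e1 s1 t1 where S: "sum g A = (e1, s1, t1)" by (cases "sum g A")
  obtain s' t' where *: "(\<Sum>i\<in>A. act (g i)) = (- e1, s', t')"
    "s' mod 157 = 2 * s1 mod 157" "t' mod 157 = 118 * t1 mod 157"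
    using insert.IH[OF S] by blast
  have e: "e = e0 + e1" "s = s0 + s1" "t = t0 + t1"
    using insert.hyps insert.prems(1) g S by simp_all
  have "(\<Sum>i\<in>insert x A. act (g i)) = (- e, 2 * s0 mod 157 + s', 118 * t0 mod 157 + t')"
    using insert.hyps *(1) by (simp add: g e)
  moreover have "(2 * s0 mod 157 + s') mod 157 = 2 * s mod 157"
    unfolding e distrib_left mod_add_left_eq by (rule mod_add_cong[OF refl *(2)])
  moreover have "(118 * t0 mod 157 + t') mod 157 = 118 * t mod 157"
    unfolding e distrib_left mod_add_left_eq by (rule mod_add_cong[OF refl *(3)])
  ultimately show ?case by blast
qed

lemma signs_\<sigma>:
  assumes "U \<in> sub 3"
  shows "signs (\<sigma> ` U) = - signs U"
proof -
  have U: "subspace U" using assms by (simp add: in_sub_iff)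
  have fin: "finite (logs U)" using finite_subset[OF logs_subset] by blast
  obtain e s t where S: "sum lab (logs U) = (e, s, t)" by (cases "sum lab (logs U)")
  obtain s' t' where *: "(\<Sum>i\<in>logs U. act (lab i)) = (- e, s', t')"
    "s' mod 157 = 2 * s mod 157" "t' mod 157 = 118 * t mod 157"
    using sum_act[OF fin S] by blast
  have "s' * s' * t' mod 157 = (2 * s) * (2 * s) * (118 * t) mod 157"
    by (rule mod_mult_cong[OF mod_mult_cong[OF *(2) *(2)] *(3)])
  \<comment> \<open>The factor is 2 * 2 * 118 = 472 = 1 + 3 * 157.\<close>
  also have "(2 * s) * (2 * s) * (118 * t) = s * s * t + 157 * (3 * (s * s * t))" by algebra
  also have "(s * s * t + 157 * (3 * (s * s * t))) mod 157 = s * s * t mod 157" by (rule mod_mult_self2)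
  finally have m: "s' * s' * t' mod 157 = s * s * t mod 157" .
  have "sum lab (logs (\<sigma> ` U)) = (- e, s', t')" unfolding sum_logs_\<sigma>[OF U] lab_Suc by (rule *(1))
  then show ?thesis unfolding signs_def S by (simp only: plane_sign.simps m abs_minus_cancel sgn_minus
    mult_minus_left)
qed

lemma odd_lab: "odd (fst (lab i))"
proof -
  have "odd (fst (act s)) = odd (fst s)" for s by (cases s) simp
  then show ?thesis unfolding lab_def by (induction i) simp_all
qed

text \<open>The alternating sum is a sum of 13 odd numbers, so it is odd and nonzero.\<close>

lemma abs_signs:
  assumes "is_space q 6 scale" "U \<in> sub 3"
  shows "\<bar>signs U\<bar> = 1"
proof -
  have fin: "finite (logs U)" using finite_subset[OF logs_subset] by blast
  have c: "card (logs U) = 13" using card_logs[OF assms] by (simp add: card3)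
  have "even (fst (sum lab A)) = even (card A)" if "finite A" for A
    using that by (induction A rule: finite_induct) (auto simp: odd_lab)
  from this[OF fin] have "odd (fst (sum lab (logs U)))" by (simp add: c)
  then have "fst (sum lab (logs U)) \<noteq> 0" by (metis even_zero)
  then show ?thesis by (cases "sum lab (logs U)") (auto simp: signs_def abs_mult)
qed

section \<open>Differences of logarithms on the checked lines, q = 3\<close>

lemma id_Suc: "i < 364 \<Longrightarrow> Suc i mod 364 = (if i = 363 then 0 else i + 1)"
  by auto

lemmas log_blocks = blocks_tab[where lab = "\<lambda>i. i" and nx = "\<lambda>i. if i = 363 then 0 else i + 1" and k = 52 and m
  = 7, OF id_Suc,
  simplified blocks_numeral blocks.simps blocks_one funpow_numeral_swap funpow_one st3 plus3 times3
    pred_numeral_simps BitM.simps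
  numeral_One simp_thms if_False if_True rel_simps nat_arith]

lemmas log_table = log_blocks[simplified runs_numeral runs_one normalize3 st3 plus3 times3 pred_numeral_simps
  BitM.simps numeral_One
  simp_thms if_False if_True rel_simps nat_arith]

definition codes :: "'k \<Rightarrow> 'k \<Rightarrow> 'k \<Rightarrow> 'k \<Rightarrow> 'k vec6 list" where
  "codes \<alpha> \<beta> \<gamma> \<delta> = [V 1 0 0 0 0 0, V 0 1 \<alpha> \<beta> \<gamma> \<delta>, V 1 1 \<alpha> \<beta> \<gamma> \<delta>,
    V 2 1 \<alpha> \<beta> \<gamma> \<delta>]"

lemma codes_line:
  "v \<in> set (codes \<alpha> \<beta> \<gamma> \<delta>) \<Longrightarrow> val v \<in> line \<alpha> \<beta> \<gamma> \<delta> \<and> v \<noteq> V 0 0 0 0 0 0"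
  unfolding codes_def by (auto simp: in_line_iff)

definition points :: "'k \<Rightarrow> 'k \<Rightarrow> 'k \<Rightarrow> 'k \<Rightarrow> nat list" where
  "points \<alpha> \<beta> \<gamma> \<delta> = map (tab (\<lambda>i. i)) (codes \<alpha> \<beta> \<gamma> \<delta>)"

lemma points_eq:
  "points 0 0 0 0 = [0, 1, 128, 359]"
  "points 0 0 0 1 = [0, 261, 7, 223]"
  "points 1 0 0 1 = [0, 306, 8, 175]"
  "points 1 1 0 1 = [0, 319, 9, 60]"
  "points 1 1 1 1 = [0, 139, 10, 228]"
  "points 1 1 1 2 = [0, 297, 11, 266]"
  "points 1 1 1 0 = [0, 52, 138, 12]"
  "points 2 2 2 2 = [0, 13, 204, 61]"
  "points 0 2 1 0 = [0, 18, 35, 15]"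
  "points 2 0 1 2 = [0, 16, 117, 185]"
  "points 0 0 1 0 = [0, 21, 305, 55]"
  "points 0 0 1 1 = [0, 190, 24, 161]"
  "points 1 0 0 2 = [0, 107, 25, 293]"
  "points 1 1 0 2 = [0, 111, 265, 26]"
  "points 2 2 2 1 = [0, 180, 27, 229]"
  "points 1 2 2 0 = [0, 252, 28, 84]"
  "points 2 0 1 0 = [0, 302, 145, 32]"
  "points 2 1 0 2 = [0, 33, 70, 163]"
  "points 1 0 2 1 = [0, 36, 50, 156]"
  "points 0 0 1 2 = [0, 122, 217, 41]"
  "points 2 0 0 0 = [0, 360, 42, 256]"
  "points 1 2 0 0 = [0, 43, 194, 118]"
  "points 0 0 0 2 = [0, 47, 292, 134]"
  "points 1 2 1 0 = [0, 187, 165, 63]"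
  "points 2 2 1 2 = [0, 64, 83, 276]"
  "points 2 0 2 2 = [0, 142, 274, 69]"
  "points 0 2 0 2 = [0, 77, 79, 200]"
  "points 0 1 2 2 = [0, 182, 91, 273]"
  "points 1 0 1 1 = [0, 149, 264, 92]"
  "points 0 2 2 2 = [0, 299, 155, 116]"
  "points 2 2 2 0 = [0, 311, 267, 341]"
  by (simp_all only: points_def codes_def list.map log_table normalize3 plus3 times3)

lemma points_zero:
  assumes "line_sum plane_sign (tab lab) \<alpha> \<beta> \<gamma> \<delta> (line_state (tab lab) \<alpha> \<beta> \<gamma> \<delta>) = 0"
  shows "list_all (\<lambda>a. list_all (\<lambda>c. a = c \<or> zero_at signs ((c + 364 - a) mod 364)) (points \<alpha> \<beta> \<gamma> \<delta>))
    (points \<alpha> \<beta> \<gamma> \<delta>)"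
proof -
  have z: "fsum signs (line \<alpha> \<beta> \<gamma> \<delta>) = 0"
    using fsum_line_eq[of plane_sign lab \<alpha> \<beta> \<gamma> \<delta>] assms by (simp add: signs_def[abs_def])
  show ?thesis unfolding list_all_iff
  proof (intro ballI, rule disjCI, rule ccontr)
    fix a c assume "a \<in> set (points \<alpha> \<beta> \<gamma> \<delta>)" "c \<in> set (points \<alpha> \<beta> \<gamma> \<delta>)" "a \<noteq> c"
      and n: "\<not> zero_at signs ((c + 364 - a) mod 364)"
    then obtain v w where v: "v \<in> set (codes \<alpha> \<beta> \<gamma> \<delta>)" "w \<in> set (codes \<alpha> \<beta> \<gamma> \<delta>)"
      and a: "a = lg (val v)" "c = lg (val w)" "lg (val v) \<noteq> lg (val w)"
      unfolding points_def set_map tab_def by blast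
    have "zero_at signs ((lg (val w) + 364 - lg (val v)) mod 364)"
      by (rule line_points_zero_at[where f = signs, OF signs_\<sigma> z]) (use codes_line v a(3) in simp_all)
    then show False using n unfolding a(1,2) by simp
  qed
qed

lemmas zeros = line_sums_zero[THEN points_zero, simplified points_eq list.pred_inject
  refl rel_simps simp_thms, simplified]

text \<open>The differences of points on the 31 lines exhaust 1, ..., 363, so every line is a shift
  of a checked one.\<close>

lemma all_zero: "avoids (\<lambda>d. \<not> zero_at signs d) (\<lambda>d. d + 1) 363 (Suc 0)"
proof -
  have "Suc 0 + 1 = 2" by simp
  then show ?thesis
    by (simp only: zeros avoids_numeral avoids_one if_False simp_thms pred_numeral_simps BitM.simps numeral_One
      nat_arith)
qed

lemma zero_at_signs: "0 < d \<Longrightarrow> d < 364 \<Longrightarrow> zero_at signs d"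
proof -
  assume d: "0 < d" "d < 364"
  have "((\<lambda>d. d + 1) ^^ i) (Suc 0) = Suc i" for i :: nat by (induction i) auto
  then show ?thesis using avoidsD[OF all_zero, of "d - 1"] d by simp
qed

lemma halving_3:
  assumes "is_space q 6 scale"
  shows "(\<exists>\<L>. large_set q 2 2 3 6 scale \<L>) \<and> (\<exists>\<B>. subspace_design q 2 6 3 20 scale \<B>)"
proof (rule halving[where f = signs, OF assms])
  fix T assume T: "T \<in> sub 2"
  show "(\<Sum>U | U \<in> sub 3 \<and> T \<subseteq> U. signs U) = 0"
    using fsum_eq_0_if_zero_at[where f = signs, OF signs_\<sigma> zero_at_signs T] by (simp add: fsum_def)
  show "card {U \<in> sub 3. T \<subseteq> U} = 2 * 20"
    using card_over_sub2[OF assms T] by (simp add: card3)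
qed (use abs_signs[OF assms] line_in_sub in auto)

end

theorem theorem5p2:
  fixes scale :: "'k::{field,finite} \<Rightarrow> 'v::{ab_group_add,finite} \<Rightarrow> 'v" and q :: nat
  assumes "q \<in> {3, 5}" and "is_space q 6 scale"
  shows "(\<exists>\<L>. large_set q 2 2 3 6 scale \<L>)
    \<and> (q = 3 \<longrightarrow> (\<exists>\<B>. subspace_design 3 2 6 3 20 scale \<B>))
    \<and> (q = 5 \<longrightarrow> (\<exists>\<B>. subspace_design 5 2 6 3 78 scale \<B>))"
proof -
  obtain val where "coordinates scale val"
    using ex_coordinates_space[OF assms(2)] by blast
  then interpret coordinates scale val .
  have c: "CARD('k) = q" using assms(2) by (simp add: is_space_def)
  consider "q = 3" | "q = 5" using assms(1) by auto
  then show ?thesis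
  proof cases
    case 1
    then interpret space3 scale val by unfold_locales (simp add: c)
    show ?thesis using halving_3[OF assms(2)] 1 by auto
  next
    case 2
    then interpret space5 scale val by unfold_locales (simp add: c)
    show ?thesis using halving_5[OF assms(2)] 2 by auto
  qed
qed

end
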